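(* There is a universal constant $C>0$ such that the following holds. Let $\mathcal{D}$ be any distribution over $[-1,1]^d\times\{1,\dots,k\}$, and let $S=((\mathbf{x}_1,y_1),\dots,(\mathbf{x}_m,y_m))$ be a training set of $m$ examples drawn i.i.d. from $\mathcal{D}$. Suppose ShareBoost is run on $S$ for $T$ iterations and let $W\in\mathbb{R}^{k\times d}$ be its output matrix. Then for every $\delta\in(0,1)$, with probability at least $1-\delta$ over the choice of $S$, $$ \Pr_{(\mathbf{x},y)\sim\mathcal{D}}\big[h_W(\mathbf{x})\neq y\big]\;\le\;\frac{1}{m}\sum_{i=1}^m \mathbf{1}[h_W(\mathbf{x}_i)\neq y_i]\;+\;C\sqrt{\frac{Tk\log(Tk)\log(k)+T\log(d)+\log(1/\delta)}{m}}. $$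
   Context: Examples are pairs $(\mathbf{x},y)$ with feature vector $\mathbf{x}\in[-1,1]^d$ and label $y\in\mathcal{Y}=\{1,\dots,k\}$. For $W\in\mathbb{R}^{k\times d}$, the predictor is $h_W(\mathbf{x})=\arg\max_{y\in\mathcal{Y}}(W\mathbf{x})_y$ (ties broken arbitrarily). The loss of $W$ on $(\mathbf{x},y)$ is $\ell(W,(\mathbf{x},y))=\ln\sum_{y'\in\mathcal{Y}}\exp\big(\mathbf{1}[y'\neq y]-(W\mathbf{x})_y+(W\mathbf{x})_{y'}\big)$, and the training loss is $L(W)=\frac1m\sum_{(\mathbf{x},y)\in S}\ell(W,(\mathbf{x},y))$. Write $\nabla_r L(W)\in\mathbb{R}^k$ for the $r$-th column of the gradient matrix $\nabla L(W)$, i.e. $\big(\partial L(W)/\partial W_{1,r},\dots,\partial L(W)/\partial W_{k,r}\big)$. The ShareBoost algorithm: initialize $W=0$, $I=\emptyset$; for $t=1,\dots,T$: choose $r\in\{1,\dots,d\}$ maximizing $\|\nabla_r L(W)\|_1$ (ties broken arbitrarily), set $I\leftarrow I\cup\{r\}$, and set $W\leftarrow\arg\min\{L(V): V\in\mathbb{R}^{k\times d},\ V_{\cdot,i}=0 \text{ for all } i\notin I\}$ (a minimizer is assumed to be attained). The output is the final $W$; it has at most $T$ nonzero columns. *)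

theory Defs
  imports "HOL-Probability.Probability"
begin

text \<open>Matrices W in R^(k x d) are functions nat => nat => real, W j r being the entry
  in row j (label j in {1..k}) and column r (feature r in {1..d}).
  Feature vectors are functions nat => real with coordinates 1..d.
  A training set of m examples is S :: nat => (nat => real) * nat, examples S 0 .. S (m-1).\<close>

type_synonym mat = "nat \<Rightarrow> nat \<Rightarrow> real"
type_synonym example = "(nat \<Rightarrow> real) \<times> nat"

definition score :: "nat \<Rightarrow> mat \<Rightarrow> (nat \<Rightarrow> real) \<Rightarrow> nat \<Rightarrow> real" where
  "score d W x j = (\<Sum>r\<in>{1..d}. W j r * x r)"

text \<open>Predictor h_W with tie-breaking rule tb: tb picks an element of the (nonempty)
  set of maximizing labels.\<close>
definition predict :: "(nat set \<Rightarrow> nat) \<Rightarrow> nat \<Rightarrow> nat \<Rightarrow> mat \<Rightarrow> (nat \<Rightarrow> real) \<Rightarrow> nat" where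
  "predict tb d k W x = tb {j\<in>{1..k}. \<forall>j'\<in>{1..k}. score d W x j' \<le> score d W x j}"

definition sb_loss :: "nat \<Rightarrow> nat \<Rightarrow> mat \<Rightarrow> example \<Rightarrow> real" where
  "sb_loss d k W z = ln (\<Sum>y'\<in>{1..k}.
      exp ((if y' \<noteq> snd z then 1 else 0) - score d W (fst z) (snd z) + score d W (fst z) y'))"

definition train_loss :: "nat \<Rightarrow> nat \<Rightarrow> nat \<Rightarrow> (nat \<Rightarrow> example) \<Rightarrow> mat \<Rightarrow> real" where
  "train_loss d k m S W = (1 / real m) * (\<Sum>i<m. sb_loss d k W (S i))"

definition grad_entry :: "nat \<Rightarrow> nat \<Rightarrow> nat \<Rightarrow> (nat \<Rightarrow> example) \<Rightarrow> mat \<Rightarrow> nat \<Rightarrow> nat \<Rightarrow> real" where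
  "grad_entry d k m S W j r =
     deriv (\<lambda>t. train_loss d k m S (\<lambda>a b. if a = j \<and> b = r then W a b + t else W a b)) 0"

definition grad_col_norm1 :: "nat \<Rightarrow> nat \<Rightarrow> nat \<Rightarrow> (nat \<Rightarrow> example) \<Rightarrow> mat \<Rightarrow> nat \<Rightarrow> real" where
  "grad_col_norm1 d k m S W r = (\<Sum>j\<in>{1..k}. \<bar>grad_entry d k m S W j r\<bar>)"

definition supported_on :: "nat \<Rightarrow> nat \<Rightarrow> nat set \<Rightarrow> mat set" where
  "supported_on d k I = {V. \<forall>j r. (j \<notin> {1..k} \<or> r \<notin> {1..d} \<or> r \<notin> I) \<longrightarrow> V j r = 0}"

text \<open>W is a possible output of ShareBoost run on S for T iterations (any admissible
  tie-breaking in the column choice and any choice of minimizer).\<close>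
definition shareboost_output ::
  "nat \<Rightarrow> nat \<Rightarrow> nat \<Rightarrow> (nat \<Rightarrow> example) \<Rightarrow> nat \<Rightarrow> mat \<Rightarrow> bool" where
  "shareboost_output d k m S T W \<longleftrightarrow>
     (\<exists>Ws :: nat \<Rightarrow> mat. \<exists>Is :: nat \<Rightarrow> nat set.
        Ws 0 = (\<lambda>_ _. 0) \<and> Is 0 = {} \<and>
        (\<forall>t<T. \<exists>r\<in>{1..d}.
            (\<forall>r'\<in>{1..d}. grad_col_norm1 d k m S (Ws t) r' \<le> grad_col_norm1 d k m S (Ws t) r) \<and>
            Is (Suc t) = insert r (Is t) \<and>
            is_arg_min (train_loss d k m S) (\<lambda>V. V \<in> supported_on d k (Is (Suc t))) (Ws (Suc t))) \<and>
        W = Ws T)"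

definition example_space :: "nat \<Rightarrow> example measure" where
  "example_space d = (\<Pi>\<^sub>M r\<in>{1..d}. (borel :: real measure)) \<Otimes>\<^sub>M count_space UNIV"

definition pop_error :: "example measure \<Rightarrow> (nat set \<Rightarrow> nat) \<Rightarrow> nat \<Rightarrow> nat \<Rightarrow> mat \<Rightarrow> real" where
  "pop_error D tb d k W = measure D {z \<in> space D. predict tb d k W (fst z) \<noteq> snd z}"

definition emp_error :: "(nat \<Rightarrow> example) \<Rightarrow> nat \<Rightarrow> (nat set \<Rightarrow> nat) \<Rightarrow> nat \<Rightarrow> nat \<Rightarrow> mat \<Rightarrow> real" where
  "emp_error S m tb d k W = (1 / real m) * (\<Sum>i<m. if predict tb d k W (fst (S i)) \<noteq> snd (S i) then 1 else 0)"

end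

theory Submission
  imports Defs
begin

text \<open>
  After $T$ rounds $W$ is supported on at most $T$ columns, so a union bound over the at most
  $d^T$ supports reduces the claim to uniform convergence for one fixed support. There the
  errors on $l$ examples are determined by the signs of $l k^2$ linear functionals of the
  $O(Tk)$ free parameters, which gives polynomially many error patterns.

  To avoid a factor $\ln m$, uniform convergence is obtained by chaining. The growth bound and
  a random subsample give $\varepsilon$-nets of size $(4nK/\varepsilon)^{2n}$, with
  $n = Tk + 1$ and $K = k^2$; an exponential-moment chaining bound for the
  sign-symmetrized process gives deviations of order $\sqrt{(n \ln (nK) + \ln(1/\delta))/m}$.

  The supremum over all real matrices need not be measurable. It is controlled by a countable
  class: predictors with rational weights that treat scores within a rational tolerance of the
  maximum as tied. Every $h_W$ is a pointwise limit of such predictors.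
\<close>

text \<open>A union bound over the error patterns on \<open>2 m\<close> points would cost about
  \<open>n ln (m K)\<close>. The entropy of a net of relative radius \<open>4^-j\<close> is
  \<open>2 n\<close> times a quantity that is linear in \<open>j\<close> and free of
  \<open>m\<close>, so its average with weights \<open>2^-j\<close> stays of order
  \<open>n ln (n K)\<close>.

  Exponential moments are kept throughout. The deviation of a set from its true measure is the mean,
  over a ghost sample, of a difference of two empirical counts, so Jensen's inequality alone brings
  in the ghost sample; no tail comparison between the true measure and the ghost frequencies has to
  be made.

  In \<open>n = T k + 1\<close> the extra unit is the tie tolerance, one more parameter that enters
  linearly; \<open>K = k * k\<close> counts the ordered pairs of labels compared on one example.

  Chaining yields the single logarithm \<open>ln (T k)\<close>. For \<open>k \<ge> 2\<close> the
  second factor \<open>ln k\<close> is at least \<open>1/2\<close> and is paid for by doubling a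
  constant. For \<open>k = 1\<close> it vanishes and no uniform deviation bound of this kind fits
  below the claim; that case holds because one label leaves nothing to misclassify.\<close>

section \<open>Exponential moments of random signs\<close>

text \<open>This is Hoeffding's bound on the logarithmic moment of a fair two-point variable: with
  \<open>h = 2 y\<close> and \<open>p = 1/2\<close> its left-hand side is
  \<open>-y + ln ((1 + exp (2 y)) / 2) = ln (cosh y)\<close>.\<close>

lemma cosh_le_exp_half_square: "cosh (x::real) \<le> exp (x\<^sup>2 / 2)"
proof -
  have *: "cosh y \<le> exp (y\<^sup>2 / 2)" if "y \<ge> 0" for y :: real
  proof -
    have pos: "1 + (exp (2 * y) - 1) / 2 > 0"
      using exp_gt_zero[of "2 * y"] by (simp add: add_pos_pos field_simps)
    have "- (2 * y) * (1 / 2) + ln (1 + 1 / 2 * (exp (2 * y) - 1)) \<le> (2 * y)\<^sup>2 / 8"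
      by (rule Hoeffdings_lemma_aux) (use that in auto)
    then have "ln (1 + (exp (2 * y) - 1) / 2) \<le> y\<^sup>2 / 2 + y"
      by (simp add: power2_eq_square)
    then have "1 + (exp (2 * y) - 1) / 2 \<le> exp (y\<^sup>2 / 2 + y)"
      using pos by (metis exp_le_cancel_iff exp_ln)
    then have "exp (- y) * (1 + (exp (2 * y) - 1) / 2) \<le> exp (- y) * exp (y\<^sup>2 / 2 + y)"
      by (intro mult_left_mono) auto
    also have "exp (- y) * exp (y\<^sup>2 / 2 + y) = exp (y\<^sup>2 / 2)"
      by (simp flip: exp_add)
    also have "exp (- y) * (1 + (exp (2 * y) - 1) / 2) = (exp (- y) + exp (- y) * exp (2 * y)) / 2"
      by (simp add: field_simps)
    also have "exp (- y) * exp (2 * y) = exp y"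
      by (simp flip: exp_add)
    finally show ?thesis by (simp add: cosh_field_def add.commute)
  qed
  show ?thesis using *[of "\<bar>x\<bar>"] by simp
qed

text \<open>Sign vectors are encoded by the set of their negative positions, so that an average over
  random signs is a finite sum over \<open>Pow {..<m}\<close> divided by \<open>2 ^ m\<close>. The
  same set later lists the coordinates exchanged with the ghost sample.\<close>

definition flip_sign :: "nat set \<Rightarrow> nat \<Rightarrow> real" where
  "flip_sign \<sigma> i = (if i \<in> \<sigma> then - 1 else 1)"

text \<open>Independence of the signs appears as the expansion of a product over subsets: the sum
  factors into the terms \<open>2 * cosh (c i)\<close>, each of which is sub-Gaussian.\<close>

lemma sum_exp_flip_sign_le:
  "(\<Sum>\<sigma>\<in>Pow {..<m}. exp (\<Sum>i<m. flip_sign \<sigma> i * c i)) \<le> 2 ^ m * exp ((\<Sum>i<m. (c i)\<^sup>2) / 2)"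
proof -
  have "(\<Prod>i<m. exp (- c i) + exp (c i)) =
      (\<Sum>\<sigma>\<in>Pow {..<m}. (\<Prod>i\<in>\<sigma>. exp (- c i)) * (\<Prod>i\<in>{..<m} - \<sigma>. exp (c i)))"
    by (rule prod_add) simp
  moreover have "\<dots> = (\<Sum>\<sigma>\<in>Pow {..<m}. exp (\<Sum>i<m. flip_sign \<sigma> i * c i))"
  proof (rule sum.cong[OF refl])
    fix \<sigma> assume \<sigma>: "\<sigma> \<in> Pow {..<m}"
    have "(\<Sum>i<m. flip_sign \<sigma> i * c i)
        = (\<Sum>i\<in>\<sigma>. flip_sign \<sigma> i * c i) + (\<Sum>i\<in>{..<m} - \<sigma>. flip_sign \<sigma> i * c i)"
      using \<sigma> by (metis PowD add.commute finite_lessThan sum.subset_diff)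
    also have "\<dots> = (\<Sum>i\<in>\<sigma>. - c i) + (\<Sum>i\<in>{..<m} - \<sigma>. c i)"
      by (intro arg_cong2[where f = "(+)"] sum.cong) (auto simp: flip_sign_def)
    finally show "(\<Prod>i\<in>\<sigma>. exp (- c i)) * (\<Prod>i\<in>{..<m} - \<sigma>. exp (c i))
        = exp (\<Sum>i<m. flip_sign \<sigma> i * c i)"
      using \<sigma> by (simp add: exp_add exp_sum finite_subset)
  qed
  moreover have cosh_double_eq: "2 * cosh x = exp x + exp (- x)" for x :: real
    by (simp add: cosh_field_def)
  ultimately have "(\<Sum>\<sigma>\<in>Pow {..<m}. exp (\<Sum>i<m. flip_sign \<sigma> i * c i)) = (\<Prod>i<m. 2 * cosh (c i))"
    by (simp add: cosh_double_eq add.commute)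
  also have "\<dots> \<le> (\<Prod>i<m. 2 * exp ((c i)\<^sup>2 / 2))"
    by (intro prod_mono) (auto simp: cosh_le_exp_half_square)
  also have "\<dots> = 2 ^ m * exp ((\<Sum>i<m. (c i)\<^sup>2) / 2)"
    by (simp add: prod.distrib exp_sum sum_divide_distrib)
  finally show ?thesis .
qed

section \<open>Growth functions and nets\<close>

definition trace_on :: "nat \<Rightarrow> (nat \<Rightarrow> 'a) \<Rightarrow> 'a set \<Rightarrow> nat set" where
  "trace_on l p A = {s. s < l \<and> p s \<in> A}"

text \<open>A growth-function condition in the form that the count of linear sign patterns delivers:
  \<open>l * K\<close> functionals in \<open>n\<close> parameters. It is demanded for every
  \<open>l\<close>, since the length used to bound a net depends on the size of that net; points may
  repeat in \<open>p\<close>.\<close>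

definition growth_bounded :: "'a set \<Rightarrow> 'a set set \<Rightarrow> nat \<Rightarrow> nat \<Rightarrow> bool" where
  "growth_bounded U F K n \<longleftrightarrow>
     (\<forall>l p. (\<forall>s<l. p s \<in> U) \<longrightarrow> card (trace_on l p ` F) \<le> (l * K + 1) ^ n)"

lemma finite_trace_on: "finite (trace_on l p ` F)"
  by (rule finite_subset[of _ "Pow {..<l}"]) (auto simp: trace_on_def)

lemma growth_bounded_mono:
  assumes "growth_bounded U F K n" "U' \<subseteq> U" "F' \<subseteq> F"
  shows "growth_bounded U' F' K n"
  unfolding growth_bounded_def
proof (intro allI impI)
  fix l and p :: "nat \<Rightarrow> 'a" assume "\<forall>s<l. p s \<in> U'"
  then have "card (trace_on l p ` F) \<le> (l * K + 1) ^ n"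
    using assms(1,2) unfolding growth_bounded_def by blast
  moreover have "card (trace_on l p ` F') \<le> card (trace_on l p ` F)"
    using assms(3) by (intro card_mono finite_trace_on image_mono)
  ultimately show "card (trace_on l p ` F') \<le> (l * K + 1) ^ n" by linarith
qed

lemma growth_bounded_exponent_mono:
  assumes "growth_bounded U F K n" "n \<le> n'"
  shows "growth_bounded U F K n'"
  unfolding growth_bounded_def
proof (intro allI impI)
  fix l and p :: "nat \<Rightarrow> 'a" assume "\<forall>s<l. p s \<in> U"
  then have "card (trace_on l p ` F) \<le> (l * K + 1) ^ n"
    using assms(1) unfolding growth_bounded_def by blast
  also have "\<dots> \<le> (l * K + 1) ^ n'" using assms(2) by (intro power_increasing) auto
  finally show "card (trace_on l p ` F) \<le> (l * K + 1) ^ n'" .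
qed

text \<open>A uniformly random sequence of length $l$ misses a given symmetric difference with
  probability at most $e^{-\varepsilon l}$, so some sequence meets all of them.\<close>
lemma separated_family_shattering_points:
  fixes \<epsilon> :: real and U :: "'a set"
  assumes U: "finite U" and H: "finite H" "\<And>A. A \<in> H \<Longrightarrow> A \<subseteq> U" and c2: "card H \<ge> 2"
    and sep: "\<And>A B. A \<in> H \<Longrightarrow> B \<in> H \<Longrightarrow> A \<noteq> B \<Longrightarrow> \<epsilon> * card U < card (sym_diff A B)"
    and l: "2 * ln (card H) \<le> \<epsilon> * l" and \<epsilon>: "0 < \<epsilon>"
  shows "\<exists>p. (\<forall>s<l. p s \<in> U) \<and> inj_on (trace_on l p) H"
proof -
  define N where "N = card U"
  define M where "M = card H"
  \<comment> \<open>\<open>bad (A, B)\<close> consists of the sequences that never enter the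
    symmetric difference and hence cannot tell \<open>A\<close> from \<open>B\<close>.\<close>
  define bad where "bad = (\<lambda>(A, B). PiE {..<l} (\<lambda>_. U - sym_diff A B))"
  define pairs where "pairs = H \<times> H - Id"
  obtain A0 B0 where "A0 \<in> H" "B0 \<in> H" "A0 \<noteq> B0"
    using c2 H by (metis One_nat_def card_le_Suc0_iff_eq not_less_eq_eq numeral_2_eq_2)
  then have "U \<noteq> {}" using H by blast
  then have N: "N > 0" using U by (auto simp: N_def card_gt_0_iff)
  have finp: "finite pairs" using H by (simp add: pairs_def)
  have "Id \<inter> H \<times> H = (\<lambda>A. (A, A)) ` H" by auto
  then have "card (Id \<inter> H \<times> H) = M" by (simp add: card_image inj_on_def M_def)
  then have cp: "card pairs = M * M - M"
    using H unfolding pairs_def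
    by (subst card_Diff_subset_Int) (auto simp: card_cartesian_product M_def Int_commute)
  have badle: "real (card (bad P)) \<le> real N ^ l / real M ^ 2" if "P \<in> pairs" for P
  proof -
    obtain A B where P: "P = (A, B)" "A \<in> H" "B \<in> H" "A \<noteq> B"
      using \<open>P \<in> pairs\<close> unfolding pairs_def by auto
    have sub: "sym_diff A B \<subseteq> U" using H P by blast
    have "real (card (U - sym_diff A B)) = real N - real (card (sym_diff A B))"
      using card_Diff_subset[OF finite_subset[OF sub U] sub] card_mono[OF U sub]
      by (simp only: N_def of_nat_diff)
    also have "\<dots> \<le> (1 - \<epsilon>) * real N"
      using sep[OF P(2-4)] by (simp add: N_def algebra_simps)
    also have "\<dots> \<le> exp (- \<epsilon>) * real N"
      using exp_ge_add_one_self[of "- \<epsilon>"] by (intro mult_right_mono) auto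
    finally have "real (card (U - sym_diff A B)) ^ l \<le> (exp (- \<epsilon>) * real N) ^ l"
      by (intro power_mono) auto
    also have "\<dots> = exp (- (\<epsilon> * l)) * real N ^ l"
      by (simp add: power_mult_distrib mult.commute flip: exp_of_nat_mult)
    also have "\<dots> \<le> exp (- (2 * ln M)) * real N ^ l"
      using l by (intro mult_right_mono) (auto simp: M_def)
    also have "exp (- (2 * ln M)) = 1 / real M ^ 2"
      using c2 by (simp add: exp_minus exp_double M_def field_simps)
    finally show ?thesis using U by (simp add: bad_def P card_PiE)
  qed
  have "real (card (\<Union> (bad ` pairs))) \<le> (\<Sum>P\<in>pairs. real (card (bad P)))"
    using card_UN_le[OF finp, of bad] by (simp flip: of_nat_sum)
  also have "\<dots> \<le> card pairs * (real N ^ l / real M ^ 2)"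
    using badle by (rule sum_bounded_above)
  \<comment> \<open>Each bad set takes at most the fraction \<open>1 / M^2\<close> of all sequences.
    Strictness comes from the missing diagonal: only \<open>M^2 - M\<close> ordered pairs occur, so
    some sequence escapes.\<close>
  also have "\<dots> < real M ^ 2 * (real N ^ l / real M ^ 2)"
  proof (rule mult_strict_right_mono)
    have "M * M - M < M * M" using c2 by (simp add: M_def)
    then show "real (card pairs) < real M ^ 2"
      unfolding cp power2_eq_square by (metis of_nat_less_iff of_nat_mult)
    show "0 < real N ^ l / real M ^ 2" using N c2 by (simp add: M_def)
  qed
  also have "\<dots> = real (card (PiE {..<l} (\<lambda>_. U)))"
    using c2 U by (simp add: M_def N_def card_PiE)
  finally have "card (\<Union> (bad ` pairs)) < card (PiE {..<l} (\<lambda>_. U))" by simp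
  moreover have "finite (\<Union> (bad ` pairs))"
    using finp U by (auto simp: bad_def intro!: finite_PiE)
  ultimately have "\<not> PiE {..<l} (\<lambda>_. U) \<subseteq> \<Union> (bad ` pairs)"
    by (meson card_mono leD)
  then obtain p where p: "p \<in> PiE {..<l} (\<lambda>_. U)" "p \<notin> \<Union> (bad ` pairs)" by blast
  have "inj_on (trace_on l p) H"
  proof (rule inj_onI, rule ccontr)
    fix A B assume AB: "A \<in> H" "B \<in> H" "trace_on l p A = trace_on l p B" "A \<noteq> B"
    have "p s \<notin> sym_diff A B" if "s < l" for s
      using AB(3) that by (auto simp: trace_on_def set_eq_iff)
    then have "p \<in> bad (A, B)" using p(1) by (auto simp: bad_def PiE_iff)
    with p(2) AB show False by (auto simp: pairs_def)
  qed
  with p(1) show ?thesis by (intro exI[of _ p]) auto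
qed

text \<open>A sequence of length about \<open>2 ln (card H) / \<epsilon>\<close> already
  distinguishes all members, so the growth bound at that length limits \<open>card H\<close>. The
  resulting inequality has \<open>ln (card H)\<close> on both sides and is solved by linearizing the
  outer logarithm.\<close>

lemma ln_card_separated_le:
  fixes \<epsilon> :: real and U :: "'a set"
  assumes U: "finite U" and H: "finite H" "\<And>A. A \<in> H \<Longrightarrow> A \<subseteq> U"
    and sep: "\<And>A B. A \<in> H \<Longrightarrow> B \<in> H \<Longrightarrow> A \<noteq> B \<Longrightarrow> \<epsilon> * card U < card (sym_diff A B)"
    and \<epsilon>: "0 < \<epsilon>" "\<epsilon> \<le> 1" and gr: "growth_bounded U H K n" and nK: "n \<ge> 1" "K \<ge> 1"
  shows "ln (card H) \<le> 2 * real n * ln (4 * real n * real K / \<epsilon>)"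
proof -
  have nK1: "1 \<le> real n * real K" using nK by (metis mult_le_mono nat_mult_1 of_nat_1 of_nat_le_iff of_nat_mult)
  have big: "1 \<le> 4 * real n * real K / \<epsilon>"
    using nK1 \<epsilon> by (simp add: field_simps)
  show ?thesis
  proof (cases "card H \<ge> 2")
    case False
    then have "card H = 0 \<or> card H = 1" by linarith
    then have "ln (real (card H)) \<le> 0" by auto
    moreover have "0 \<le> 2 * real n * ln (4 * real n * real K / \<epsilon>)" using big by simp
    ultimately show ?thesis by linarith
  next
    case True
    define x where "x = ln (card H)"
    define l where "l = nat \<lceil>2 * x / \<epsilon>\<rceil>"
    have x0: "x \<ge> 0" using True by (simp add: x_def)
    have l1: "2 * x / \<epsilon> \<le> l" unfolding l_def by linarith
    have l2: "l \<le> 2 * x / \<epsilon> + 1" using x0 \<epsilon> unfolding l_def by (simp add: of_nat_nat)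
    have "2 * ln (card H) \<le> \<epsilon> * l" using l1 \<epsilon> by (simp add: x_def field_simps)
    then obtain p where p: "\<forall>s<l. p s \<in> U" "inj_on (trace_on l p) H"
      using separated_family_shattering_points[OF U H True sep _ \<epsilon>(1)] by blast
    have "card H = card (trace_on l p ` H)" using p(2) by (simp add: card_image)
    also have "\<dots> \<le> (l * K + 1) ^ n" using gr p(1) unfolding growth_bounded_def by blast
    finally have "real (card H) \<le> real ((l * K + 1) ^ n)" by (simp only: of_nat_le_iff)
    also have "\<dots> = (real l * K + 1) ^ n" by (simp add: add.commute)
    finally have "x \<le> ln ((real l * K + 1) ^ n)"
      unfolding x_def using True by (intro ln_mono) auto
    also have "\<dots> = real n * ln (real l * K + 1)" by (simp add: ln_realpow add_nonneg_pos)
    \<comment> \<open>The split is scaled so that \<open>ln z \<le> z - 1\<close> at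
      \<open>z = (x + 1) / (2 n)\<close> contributes only \<open>x / 2 + 1 / 2 - n\<close>; half of
      \<open>x\<close> survives on the left, and \<open>n \<ge> 1\<close> swallows the rest.\<close>
    also have "\<dots> \<le> real n * ln ((4 * real n * real K / \<epsilon>) * ((x + 1) / (2 * real n)))"
    proof (intro mult_left_mono ln_mono)
      have "real l * K + 1 \<le> (2 * x / \<epsilon> + 1) * K + 1"
        using l2 by (intro add_right_mono mult_right_mono) auto
      also have "\<dots> \<le> 2 * x / \<epsilon> * K + 2 * real K" using nK by (simp add: algebra_simps)
      also have "2 * real K \<le> 2 * real K / \<epsilon>" using \<epsilon> nK by (simp add: field_simps)
      also have "2 * x / \<epsilon> * K + 2 * real K / \<epsilon> = (4 * real n * real K / \<epsilon>) * ((x + 1) / (2 * real n))"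
        using \<epsilon> nK by (simp add: field_simps)
      finally show "real l * K + 1 \<le> (4 * real n * real K / \<epsilon>) * ((x + 1) / (2 * real n))" by simp
    qed (auto simp: add_nonneg_pos)
    also have "\<dots> = real n * (ln (4 * real n * real K / \<epsilon>) + ln ((x + 1) / (2 * real n)))"
      using big x0 nK \<epsilon> by (subst ln_mult) auto
    also have "\<dots> \<le> real n * (ln (4 * real n * real K / \<epsilon>) + ((x + 1) / (2 * real n) - 1))"
      using x0 nK by (intro mult_left_mono add_left_mono ln_le_minus_one) auto
    also have "\<dots> = real n * ln (4 * real n * real K / \<epsilon>) + (x + 1) / 2 - n"
      using nK by (simp add: field_simps)
    finally have "x / 2 \<le> real n * ln (4 * real n * real K / \<epsilon>)"
      using nK(1) by (simp add: field_simps)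
    then show ?thesis by (simp add: x_def)
  qed
qed

text \<open>A maximal separated subfamily is a net: a member far from all of it could be added. Its
  size is bounded because it is separated.\<close>

lemma small_net_exists:
  fixes \<epsilon> :: real and U :: "'a set"
  assumes U: "finite U" and F: "finite F" "\<And>A. A \<in> F \<Longrightarrow> A \<subseteq> U"
    and \<epsilon>: "0 < \<epsilon>" "\<epsilon> \<le> 1" and gr: "growth_bounded U F K n" and nK: "n \<ge> 1" "K \<ge> 1"
  shows "\<exists>H\<subseteq>F. ln (card H) \<le> 2 * real n * ln (4 * real n * real K / \<epsilon>) \<and>
           (\<forall>A\<in>F. \<exists>B\<in>H. card (sym_diff A B) \<le> \<epsilon> * card U)"
proof -
  define sep where "sep = (\<lambda>H :: 'a set set. \<forall>A\<in>H. \<forall>B\<in>H. A \<noteq> B \<longrightarrow> \<epsilon> * card U < card (sym_diff A B))"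
  have "finite {H. H \<subseteq> F \<and> sep H}" using F by simp
  moreover have "{} \<in> {H. H \<subseteq> F \<and> sep H}" by (simp add: sep_def)
  ultimately obtain H where H: "H \<subseteq> F" "sep H" and max: "\<And>H'. H' \<subseteq> F \<Longrightarrow> sep H' \<Longrightarrow> H \<subseteq> H' \<Longrightarrow> H = H'"
    using finite_has_maximal2[of "{H. H \<subseteq> F \<and> sep H}" "{}"] by (metis (no_types, lifting) mem_Collect_eq)
  have "\<exists>B\<in>H. card (sym_diff A B) \<le> \<epsilon> * card U" if A: "A \<in> F" for A
  proof (rule ccontr)
    assume "\<not> ?thesis"
    then have far: "\<forall>B\<in>H. \<epsilon> * card U < card (sym_diff A B)" by force
    have "sep (insert A H)"
      unfolding sep_def
    proof (intro ballI impI)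
      fix X Y assume XY: "X \<in> insert A H" "Y \<in> insert A H" "X \<noteq> Y"
      consider "X = A" "Y \<in> H" | "Y = A" "X \<in> H" | "X \<in> H" "Y \<in> H" using XY by blast
      then show "\<epsilon> * card U < card (sym_diff X Y)"
      proof cases
        case 2 then show ?thesis using far by (metis Un_commute)
      qed (use far H(2) XY(3) in \<open>auto simp: sep_def\<close>)
    qed
    then have "A \<in> H" using max[of "insert A H"] H A by blast
    then have "\<epsilon> * card U < 0" using bspec[OF far, of A] by simp
    then show False using \<epsilon> by (simp add: mult_less_0_iff)
  qed
  moreover have "ln (card H) \<le> 2 * real n * ln (4 * real n * real K / \<epsilon>)"
    using H finite_subset[OF H(1) F(1)] subsetD[OF H(1), THEN F(2)]
    by (intro ln_card_separated_le[OF U _ _ _ \<epsilon> growth_bounded_mono[OF gr order_refl] nK])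
       (simp_all add: sep_def)
  ultimately show ?thesis using H(1) by blast
qed

section \<open>Counting sign patterns of linear functionals\<close>

text \<open>Deletion--restriction: the cells of the other functionals are convex, so a cell
  on which the last functional takes both signs meets its kernel.\<close>
lemma card_linear_sign_patterns_le:
  fixes b :: "'j \<Rightarrow> 'i \<Rightarrow> real"
  assumes "finite X" "finite J"
  shows "card (range (\<lambda>c. {i \<in> X. 0 \<le> (\<Sum>j\<in>J. c j * b j i)})) \<le> (card X + 1) ^ card J"
  using assms
proof (induction X arbitrary: J b rule: finite_induct)
  case empty
  then show ?case by simp
next
  case (insert x X)
  define v where "v c i = (\<Sum>j\<in>J. c j * b j i)" for c i
  define pat where "pat Y c = {i \<in> Y. 0 \<le> v c i}" for Y c
  have finr: "finite (range (pat Y))" if "finite Y" for Y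
    by (rule finite_subset[of _ "Pow Y"]) (use that in \<open>auto simp: pat_def\<close>)
  define S0 where "S0 = {A \<in> range (pat (insert x X)). x \<notin> A}"
  define S1 where "S1 = {A \<in> range (pat (insert x X)). x \<in> A}"
  define S1' where "S1' = (\<lambda>A. A - {x}) ` S1"
  have fin: "finite S0" "finite S1" using finr insert.hyps by (auto simp: S0_def S1_def)
  have "range (pat (insert x X)) = S0 \<union> S1" by (auto simp: S0_def S1_def)
  then have "card (range (pat (insert x X))) \<le> card S0 + card S1" by (simp add: card_Un_le)
  also have "card S1 = card S1'"
    unfolding S1'_def by (subst card_image) (auto simp: inj_on_def S1_def)
  \<comment> \<open>After deletion of \<open>x\<close>, the union consists of patterns on
    \<open>X\<close>, and the intersection of those patterns on \<open>X\<close> that extend to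
    \<open>x\<close> with either sign.\<close>
  also have "card S0 + card S1' = card (S0 \<union> S1') + card (S0 \<inter> S1')"
    using fin by (intro card_Un_Int) (auto simp: S1'_def)
  finally have split: "card (range (pat (insert x X))) \<le> card (S0 \<union> S1') + card (S0 \<inter> S1')" .
  have S0: "\<exists>c. v c x < 0 \<and> A = pat X c" if A: "A \<in> S0" for A
  proof -
    obtain c where "A = pat (insert x X) c" "x \<notin> A" using A unfolding S0_def by blast
    then show ?thesis by (intro exI[of _ c]) (use insert.hyps in \<open>auto simp: pat_def\<close>)
  qed
  have S1': "\<exists>c. 0 \<le> v c x \<and> A = pat X c" if A: "A \<in> S1'" for A
  proof -
    obtain c where "A = pat (insert x X) c - {x}" "x \<in> pat (insert x X) c"
      using A unfolding S1'_def S1_def by blast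
    then show ?thesis by (intro exI[of _ c]) (use insert.hyps in \<open>auto simp: pat_def\<close>)
  qed
  have "card (S0 \<union> S1') \<le> card (range (pat X))"
    using S0 S1' finr[OF insert.hyps(1)] by (intro card_mono) blast+
  also have "\<dots> \<le> (card X + 1) ^ card J"
    using insert.IH[OF insert.prems, of b] by (simp add: pat_def v_def)
  finally have c1: "card (S0 \<union> S1') \<le> (card X + 1) ^ card J" .
  show ?case
  proof (cases "\<exists>j\<in>J. b j x \<noteq> 0")
    case False
    then have "v c x = 0" for c by (simp add: v_def)
    then have "S0 = {}" using S0 by fastforce
    then have "card (range (pat (insert x X))) \<le> (card X + 1) ^ card J" using split c1 by simp
    also have "\<dots> \<le> (Suc (card X) + 1) ^ card J" by (intro power_mono) auto
    finally show ?thesis using insert.hyps by (simp add: pat_def v_def)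
  next
    case True
    then obtain j0 where j0: "j0 \<in> J" "b j0 x \<noteq> 0" by blast
    \<comment> \<open>Solving \<open>v c x = 0\<close> for the coordinate \<open>c j0\<close>
      restricts the other functionals to the kernel; \<open>b'\<close> holds their coefficients in
      the remaining coordinates.\<close>
    define b' where "b' j i = b j i - b j x / b j0 x * b j0 i" for j i
    have kernel: "v c i = (\<Sum>j\<in>J - {j0}. c j * b' j i)" if "v c x = 0" for c i
    proof -
      have "c j0 * b j0 x = - (\<Sum>j\<in>J - {j0}. c j * b j x)"
        using that sum.remove[OF insert.prems j0(1), of "\<lambda>j. c j * b j x"] by (simp add: v_def)
      then have "c j0 = - (\<Sum>j\<in>J - {j0}. c j * b j x) / b j0 x" using j0(2) by (simp add: field_simps)
      moreover have "(\<Sum>j\<in>J - {j0}. c j * b' j i) =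
          (\<Sum>j\<in>J - {j0}. c j * b j i) - (\<Sum>j\<in>J - {j0}. c j * b j x) / b j0 x * b j0 i"
        by (simp add: b'_def right_diff_distrib sum_subtractf sum_distrib_right sum_divide_distrib mult.assoc)
      ultimately show ?thesis
        using sum.remove[OF insert.prems j0(1), of "\<lambda>j. c j * b j i"] by (simp add: v_def)
    qed
    have "S0 \<inter> S1' \<subseteq> range (\<lambda>c. {i \<in> X. 0 \<le> (\<Sum>j\<in>J - {j0}. c j * b' j i)})"
    proof
      fix A assume "A \<in> S0 \<inter> S1'"
      then obtain c c' where c: "v c x < 0" "A = pat X c" and c': "0 \<le> v c' x" "A = pat X c'"
        using S0 S1' by blast
      \<comment> \<open>The segment from \<open>c'\<close> to \<open>c\<close> meets the kernel at
        this weight. Since only \<open>v c x\<close> is strictly signed, \<open>s = 0\<close> can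
        occur but \<open>s = 1\<close> cannot; the positive weight of \<open>c'\<close> keeps
        negative values strictly negative.\<close>
      define s where "s = v c' x / (v c' x - v c x)"
      have s: "0 \<le> s" "s < 1" using c c' by (auto simp: s_def field_simps)
      define e where "e j = s * c j + (1 - s) * c' j" for j
      have ve: "v e i = s * v c i + (1 - s) * v c' i" for i
        by (simp add: v_def e_def sum_distrib_left algebra_simps flip: sum.distrib)
      have "v e x = v c' x - s * (v c' x - v c x)" unfolding ve by (simp add: algebra_simps)
      also have "\<dots> = 0" using c c' by (simp add: s_def)
      finally have ker: "v e x = 0" .
      have "0 \<le> v e i \<longleftrightarrow> 0 \<le> v c i" if "i \<in> X" for i
      proof -
        have iff: "0 \<le> v c i \<longleftrightarrow> 0 \<le> v c' i" using c(2) c'(2) that by (auto simp: pat_def)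
        show ?thesis
        proof (cases "0 \<le> v c i")
          case True
          then show ?thesis using iff s unfolding ve by (simp add: add_nonneg_nonneg)
        next
          case False
          then have "s * v c i \<le> 0" "(1 - s) * v c' i < 0"
            using iff s by (auto simp: mult_le_0_iff mult_less_0_iff)
          then show ?thesis using False unfolding ve by linarith
        qed
      qed
      then have "A = pat X e" using c(2) by (auto simp: pat_def)
      then show "A \<in> range (\<lambda>c. {i \<in> X. 0 \<le> (\<Sum>j\<in>J - {j0}. c j * b' j i)})"
        unfolding pat_def kernel[OF ker] by blast
    qed
    moreover have "finite (range (\<lambda>c. {i \<in> X. 0 \<le> (\<Sum>j\<in>J - {j0}. c j * b' j i)}))"
      by (rule finite_subset[of _ "Pow X"]) (use insert.hyps in auto)
    ultimately have "card (S0 \<inter> S1') \<le> (card X + 1) ^ card (J - {j0})"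
      using card_mono insert.IH[of "J - {j0}" b'] insert.prems by (meson finite_Diff le_trans)
    moreover obtain r where r: "card J = Suc r" "card (J - {j0}) = r"
      using j0(1) insert.prems by (metis card.remove card_Diff_singleton diff_Suc_1)
    ultimately have "card (range (pat (insert x X))) \<le> (card X + 1) ^ Suc r + (card X + 1) ^ r"
      using split c1 by simp
    \<comment> \<open>With \<open>N = card X + 1\<close> the recursion reads
      \<open>N ^ (r + 1) + N ^ r = (N + 1) * N ^ r\<close>, which is at most
      \<open>(N + 1) ^ (r + 1)\<close>.\<close>
    also have "\<dots> = (Suc (card X) + 1) * (card X + 1) ^ r" by simp
    also have "\<dots> \<le> (Suc (card X) + 1) ^ Suc r"
      unfolding power_Suc by (intro mult_left_mono power_mono) auto
    finally show ?thesis using r insert.hyps by (simp add: pat_def v_def)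
  qed
qed

section \<open>Chaining\<close>

text \<open>Here \<open>A\<close> is the set of indices below \<open>2 * m\<close> whose points lie
  in a given event: the value is the ghost count minus the sample count after the pairs
  \<open>i\<close>, \<open>m + i\<close> with \<open>i \<in> \<sigma>\<close> have been
  exchanged.\<close>

definition swap_dev :: "nat \<Rightarrow> nat set \<Rightarrow> nat set \<Rightarrow> real" where
  "swap_dev m \<sigma> A = (\<Sum>i<m. flip_sign \<sigma> i * (indicator A (m + i) - indicator A i))"

text \<open>The increments of the process are sub-Gaussian for the Hamming metric on index sets. The
  coefficient of sign \<open>i\<close> collects the two indices \<open>i\<close> and
  \<open>m + i\<close>; by \<open>(a - b)^2 \<le> 2 (a^2 + b^2)\<close> each element of the
  symmetric difference is charged once.\<close>

lemma sum_exp_swap_dev_diff_le: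
  assumes A: "A \<subseteq> {..<2 * m}" and B: "B \<subseteq> {..<2 * m}"
  shows "(\<Sum>\<sigma>\<in>Pow {..<m}. exp (t * (swap_dev m \<sigma> A - swap_dev m \<sigma> B)))
           \<le> 2 ^ m * exp (t\<^sup>2 * card (sym_diff A B))"
proof -
  let ?D = "sym_diff A B"
  define c where "c i = t * ((indicator A (m + i) - indicator A i) - (indicator B (m + i) - indicator B i))" for i
  have "(c i)\<^sup>2 \<le> 2 * t\<^sup>2 * (indicator ?D (m + i) + indicator ?D i)" for i
  proof -
    let ?a = "indicator A (m + i) - indicator B (m + i) :: real"
    let ?b = "indicator A i - indicator B i :: real"
    have "(c i)\<^sup>2 = t\<^sup>2 * (?a - ?b)\<^sup>2"
      unfolding c_def power_mult_distrib by (simp add: algebra_simps)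
    also have "\<dots> \<le> t\<^sup>2 * (2 * (?a\<^sup>2 + ?b\<^sup>2))"
      using zero_le_power2[of "?a + ?b"]
      by (intro mult_left_mono) (simp_all add: power2_eq_square algebra_simps)
    also have "?a\<^sup>2 = indicator ?D (m + i)" by (auto simp: indicator_def)
    also have "?b\<^sup>2 = indicator ?D i" by (auto simp: indicator_def)
    finally show ?thesis by (simp add: algebra_simps)
  qed
  then have "(\<Sum>i<m. (c i)\<^sup>2) \<le> (\<Sum>i<m. 2 * t\<^sup>2 * (indicator ?D (m + i) + indicator ?D i))"
    by (intro sum_mono) auto
  also have "\<dots> = 2 * t\<^sup>2 * ((\<Sum>i<m. indicator ?D i) + (\<Sum>i<m. indicator ?D (m + i)))"
    by (simp add: sum_distrib_left sum.distrib distrib_left add.commute)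
  also have "(\<Sum>i<m. indicator ?D i) + (\<Sum>i<m. indicator ?D (m + i)) = (\<Sum>i<m + m. indicator ?D i :: real)"
    by (simp add: lessThan_atLeast0 sum.shift_bounds_nat_ivl[of _ 0 m m, simplified, symmetric]
          sum.atLeastLessThan_concat add.commute numeral_2_eq_2)
  also have "\<dots> = card ?D"
  proof -
    have "?D \<subseteq> {..<m + m}" using A B by auto
    then have "(\<Sum>i<m + m. indicator ?D i :: real) = (\<Sum>i\<in>?D. 1)"
      by (intro sum.mono_neutral_cong_right) auto
    then show ?thesis by simp
  qed
  finally have "(\<Sum>i<m. (c i)\<^sup>2) / 2 \<le> t\<^sup>2 * card ?D" by simp
  then have "2 ^ m * exp ((\<Sum>i<m. (c i)\<^sup>2) / 2) \<le> 2 ^ m * exp (t\<^sup>2 * card ?D)" by simp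
  moreover have "t * (swap_dev m \<sigma> A - swap_dev m \<sigma> B) = (\<Sum>i<m. flip_sign \<sigma> i * c i)" for \<sigma>
    unfolding swap_dev_def c_def
    by (simp add: sum_distrib_left algebra_simps flip: sum_subtractf)
  ultimately show ?thesis using order_trans[OF sum_exp_flip_sign_le[where m = m and c = c]] by (simp only:)
qed

text \<open>Jensen's inequality for the weights \<open>1/2, 1/4, ...\<close>, with the leftover mass
  \<open>(1/2) ^ J\<close> placed at \<open>0\<close>, where \<open>exp\<close> is \<open>1\<close>.
  Induction peels off the first term by midpoint convexity.\<close>

lemma exp_dyadic_average_le:
  "exp (\<Sum>j<J. (1/2) ^ Suc j * a j) \<le> (\<Sum>j<J. (1/2) ^ Suc j * exp (a j)) + (1/2) ^ J" for a :: "nat \<Rightarrow> real"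
proof (induction J arbitrary: a)
  case (Suc J)
  have mid: "exp ((x + y) / 2) \<le> (exp x + exp y) / 2" for x y :: real
  proof -
    have "0 \<le> (exp (x / 2) - exp (y / 2))\<^sup>2" by simp
    also have "\<dots> = exp (x / 2) ^ 2 + exp (y / 2) ^ 2 - 2 * (exp (x / 2) * exp (y / 2))"
      by (simp add: power2_eq_square algebra_simps)
    also have "\<dots> = exp x + exp y - 2 * exp ((x + y) / 2)"
      by (simp add: power2_eq_square add_divide_distrib flip: exp_add)
    finally show ?thesis by simp
  qed
  define b where "b = (\<Sum>j<J. (1/2) ^ Suc j * a (Suc j))"
  have "(\<Sum>j<Suc J. (1/2) ^ Suc j * a j) = (a 0 + b) / 2"
    by (simp add: b_def sum.lessThan_Suc_shift sum_divide_distrib add_divide_distrib del: sum.lessThan_Suc)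
  then have "exp (\<Sum>j<Suc J. (1/2) ^ Suc j * a j) \<le> (exp (a 0) + exp b) / 2"
    using mid[of "a 0" b] by (simp only:)
  also have "\<dots> \<le> (exp (a 0) + ((\<Sum>j<J. (1/2) ^ Suc j * exp (a (Suc j))) + (1/2) ^ J)) / 2"
    using Suc.IH[of "\<lambda>j. a (Suc j)"] by (simp add: b_def)
  also have "\<dots> = (\<Sum>j<Suc J. (1/2) ^ Suc j * exp (a j)) + (1/2) ^ Suc J"
    by (simp add: sum.lessThan_Suc_shift sum_divide_distrib add_divide_distrib del: sum.lessThan_Suc)
  finally show ?case .
qed simp

lemma sum_dyadic_weights: "(\<Sum>j<J. (1/2) ^ Suc j) = 1 - (1/2 :: real) ^ J"
  by (induction J) (auto simp: field_simps)

lemma sum_dyadic_linear_le: "(\<Sum>j<J. (1/2) ^ Suc j * real (Suc j)) \<le> 2"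
proof -
  have "(\<Sum>j<J. (1/2) ^ Suc j * real (Suc j)) = 2 - (real J + 2) * (1/2) ^ J"
    by (induction J) (auto simp: field_simps)
  then show ?thesis by simp
qed

text \<open>Chaining with the nets of radius $4^{-j}$ and exponential weights $2^{-j}$: as the
  squared increments at level $j$ shrink like $4^{-j}$, all levels contribute the same
  variance proxy, and the entropies $\ln |N_j|$ only enter through their $2^{-j}$-average.\<close>
lemma sum_exp_Max_swap_dev_le:
  assumes m: "m \<ge> 1" and F: "finite F" "F \<noteq> {}" "\<And>A. A \<in> F \<Longrightarrow> A \<subseteq> {..<2 * m}"
    and gr: "growth_bounded {..<2 * m} F K n" and nK: "n \<ge> 1" "K \<ge> 1"
  shows "(\<Sum>\<sigma>\<in>Pow {..<m}. exp (t * (MAX A\<in>F. swap_dev m \<sigma> A)))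
           \<le> 2 ^ m * exp (12 * real n * ln (4 * real n * real K) + 10 * t\<^sup>2 * m)"
proof -
  define L where "L = ln (4 * real n * real K)"
  have nK1: "1 \<le> real n * real K"
    using nK by (metis mult_le_mono nat_mult_1 of_nat_1 of_nat_le_iff of_nat_mult)
  have L4: "ln 4 \<le> L" unfolding L_def using nK1 by (intro ln_mono) auto
  then have L0: "0 \<le> L" using ln_ge_zero[of "4::real"] by linarith
  have "\<exists>H. H \<subseteq> F \<and> ln (card H) \<le> 2 * real n * ln (4 * real n * real K / (1/4) ^ j) \<and>
           (\<forall>A\<in>F. \<exists>B\<in>H. card (sym_diff A B) \<le> (1/4) ^ j * real (card {..<2 * m}))" for j
    using small_net_exists[of "{..<2 * m}" F "(1/4) ^ j" K n] F gr nK
    by (auto simp: power_le_one)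
  then obtain N where N: "\<And>j. N j \<subseteq> F"
    "\<And>j. ln (card (N j)) \<le> 2 * real n * ln (4 * real n * real K / (1/4) ^ j)"
    "\<And>j A. A \<in> F \<Longrightarrow> \<exists>B\<in>N j. card (sym_diff A B) \<le> (1/4) ^ j * real (card {..<2 * m})"
    by metis
  \<comment> \<open>Level \<open>0\<close> projects everything to the empty set, whose deviation is
    zero. It need not belong to \<open>F\<close>; its distance to any member is at most
    \<open>2 * m\<close>, as radius \<open>4^0\<close> requires.\<close>
  define \<pi> where "\<pi> j A = (if j = 0 then {} else
    (SOME B. B \<in> N j \<and> card (sym_diff A B) \<le> (1/4) ^ j * real (card {..<2 * m})))" for j A
  have \<pi>: "\<pi> j A \<in> N j" "card (sym_diff A (\<pi> j A)) \<le> (1/4) ^ j * (2 * real m)"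
    if "A \<in> F" "j > 0" for j A
    using someI_ex[OF N(3)[OF that(1), of j, unfolded Bex_def]] that by (auto simp: \<pi>_def)
  have \<pi>0: "\<pi> 0 A = {}" for A by (simp add: \<pi>_def)
  have dist: "card (sym_diff A (\<pi> j A)) \<le> (1/4) ^ j * (2 * real m)" if "A \<in> F" for j A
  proof (cases "j = 0")
    case True
    then show ?thesis using card_mono[OF _ F(3)[OF that]] by (simp add: \<pi>0)
  qed (use \<pi> that in auto)
  have sub: "\<pi> j A \<subseteq> {..<2 * m}" if "A \<in> F" for j A
    using \<pi>(1)[OF that, of j] N(1) F(3) \<pi>0 by (cases "j = 0") blast+
  have card\<pi>: "ln (card (\<pi> j ` F)) \<le> 2 * real n * (L + j * ln 4)" for j
  proof (cases "j = 0")
    case True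
    have "\<pi> 0 ` F = {{}}" using F(2) \<pi>0 by auto
    then show ?thesis using True L0 by simp
  next
    case False
    have "card (\<pi> j ` F) \<le> card (N j)"
      using \<pi>(1) False finite_subset[OF N(1) F(1)] by (intro card_mono) auto
    then have "ln (card (\<pi> j ` F)) \<le> ln (card (N j))"
      using F by (intro ln_mono) (auto simp: card_gt_0_iff)
    also note N(2)[of j]
    also have "ln (4 * real n * real K / (1/4) ^ j) = L + j * ln 4"
      using nK by (simp add: L_def ln_div ln_realpow power_divide ln_mult)
    finally show ?thesis .
  qed
  define \<Lambda> where "\<Lambda> j = (\<lambda>A. (\<pi> (Suc j) A, \<pi> j A)) ` F" for j
  \<comment> \<open>\<open>q j\<close> bounds the logarithm of the number of links at level
    \<open>j\<close>: two nets, each of entropy at most \<open>2 n (L + (j + 1) ln 4)\<close>.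
    Subtracting it in the exponent pays for the sum over all links.\<close>
  define q where "q j = 4 * real n * (L + real (Suc j) * ln 4)" for j
  have fin\<Lambda>: "finite (\<Lambda> j)" for j using F by (simp add: \<Lambda>_def)
  have card\<Lambda>: "card (\<Lambda> j) * exp (- q j) \<le> 1" for j
  proof -
    have pos: "card (\<pi> i ` F) > 0" for i using F by (simp add: card_gt_0_iff)
    have "card (\<Lambda> j) \<le> card (\<pi> (Suc j) ` F \<times> \<pi> j ` F)"
      using F by (intro card_mono) (auto simp: \<Lambda>_def)
    then have "real (card (\<Lambda> j)) \<le> real (card (\<pi> (Suc j) ` F)) * real (card (\<pi> j ` F))"
      by (simp add: card_cartesian_product flip: of_nat_mult)
    also have "\<dots> = exp (ln (card (\<pi> (Suc j) ` F)) + ln (card (\<pi> j ` F)))"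
      using pos by (simp add: exp_add)
    also have "\<dots> \<le> exp (q j)"
    proof -
      have "2 * real n * (L + j * ln 4) \<le> 2 * real n * (L + Suc j * ln 4)"
        by (intro mult_left_mono add_left_mono mult_right_mono) auto
      then show ?thesis using card\<pi>[of "Suc j"] card\<pi>[of j] by (simp add: q_def)
    qed
    finally show ?thesis by (simp add: exp_minus field_simps)
  qed
  \<comment> \<open>At this depth the radius is below one element, so the projection is exact and
    the chain is finite.\<close>
  obtain J where "(1/4 :: real) ^ J < 1 / (2 * m)"
    using real_arch_pow_inv[of "1 / (2 * m)" "1/4 :: real"] m by auto
  then have J: "(1/4) ^ J * (2 * real m) < 1" using m by (simp add: field_simps)
  have \<pi>J: "\<pi> J A = A" if "A \<in> F" for A
  proof -
    have "card (sym_diff A (\<pi> J A)) = 0" using dist[OF that, of J] J by linarith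
    moreover have "finite (sym_diff A (\<pi> J A))"
      using F(3)[OF that] sub[OF that, of J] by (meson finite_Diff finite_UnI finite_lessThan finite_subset)
    ultimately have "sym_diff A (\<pi> J A) = {}" by simp
    then show ?thesis by blast
  qed
  define X where "X = swap_dev m"
  have X0: "X \<sigma> {} = 0" for \<sigma> by (simp add: X_def swap_dev_def)
  define Q where "Q = 12 * real n * L"
  have Q: "(\<Sum>j<J. (1/2) ^ Suc j * q j) \<le> Q"
  proof -
    have "(\<Sum>j<J. (1/2) ^ Suc j * q j) =
        4 * real n * (L * (\<Sum>j<J. (1/2) ^ Suc j) + ln 4 * (\<Sum>j<J. (1/2) ^ Suc j * real (Suc j)))"
      by (simp only: q_def sum_distrib_left flip: sum.distrib) (simp add: field_simps)
    \<comment> \<open>Since \<open>ln 4 \<le> L\<close>, the part linear in \<open>j\<close> is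
      absorbed into \<open>L\<close>; this is the origin of \<open>12 = 4 * (1 + 2)\<close>.\<close>
    also have "\<dots> \<le> 4 * real n * (L * 1 + L * 2)"
      using L0 L4 sum_dyadic_linear_le[of J] unfolding sum_dyadic_weights
      by (intro mult_left_mono add_mono mult_mono sum_nonneg) auto
    finally show ?thesis by (simp add: Q_def)
  qed
  \<comment> \<open>The factor \<open>2 ^ Suc j\<close> in the exponent undoes the averaging weight,
    so the dyadic average of the exponents is \<open>t\<close> times the telescoped chain minus the
    average of the \<open>q j\<close>.\<close>
  define R where "R \<sigma> = (\<Sum>j<J. (1/2) ^ Suc j *
      (\<Sum>P\<in>\<Lambda> j. exp (2 ^ Suc j * t * (X \<sigma> (fst P) - X \<sigma> (snd P)) - q j))) + (1/2) ^ J" for \<sigma>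
  have pointwise: "exp (t * (MAX A\<in>F. X \<sigma> A)) \<le> exp Q * R \<sigma>" for \<sigma>
  proof -
    obtain A where A: "A \<in> F" "(MAX A\<in>F. X \<sigma> A) = X \<sigma> A"
      using Max_in[of "X \<sigma> ` F"] F(1,2) by (metis finite_imageI image_iff image_is_empty)
    define a where "a j = 2 ^ Suc j * t * (X \<sigma> (\<pi> (Suc j) A) - X \<sigma> (\<pi> j A)) - q j" for j
    have "t * X \<sigma> A = t * (X \<sigma> (\<pi> J A) - X \<sigma> (\<pi> 0 A))" using \<pi>J[OF A(1)] X0 \<pi>0 by simp
    also have "\<dots> = (\<Sum>j<J. t * (X \<sigma> (\<pi> (Suc j) A) - X \<sigma> (\<pi> j A)))"
      using sum_lessThan_telescope[of "\<lambda>j. X \<sigma> (\<pi> j A)" J] by (simp flip: sum_distrib_left)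
    also have "\<dots> = (\<Sum>j<J. (1/2) ^ Suc j * a j) + (\<Sum>j<J. (1/2) ^ Suc j * q j)"
    proof (subst sum.distrib[symmetric], intro sum.cong refl)
      fix j
      have "(1/2) ^ Suc j * (2 ^ Suc j :: real) = 1" by (simp flip: power_mult_distrib)
      then show "t * (X \<sigma> (\<pi> (Suc j) A) - X \<sigma> (\<pi> j A)) = (1/2) ^ Suc j * a j + (1/2) ^ Suc j * q j"
        unfolding a_def by (simp only: right_diff_distrib mult.assoc[symmetric])
    qed
    finally have "t * X \<sigma> A \<le> (\<Sum>j<J. (1/2) ^ Suc j * a j) + Q" using Q by linarith
    then have "exp (t * X \<sigma> A) \<le> exp Q * exp (\<Sum>j<J. (1/2) ^ Suc j * a j)"
      by (simp add: add.commute flip: exp_add)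
    also have "\<dots> \<le> exp Q * ((\<Sum>j<J. (1/2) ^ Suc j * exp (a j)) + (1/2) ^ J)"
      by (intro mult_left_mono exp_dyadic_average_le) auto
    also have "\<dots> \<le> exp Q * R \<sigma>"
      unfolding R_def
    proof (intro mult_left_mono add_right_mono sum_mono)
      fix j
      have "(\<pi> (Suc j) A, \<pi> j A) \<in> \<Lambda> j" using A(1) by (simp add: \<Lambda>_def)
      from member_le_sum[OF this _ fin\<Lambda>,
          of "\<lambda>P. exp (2 ^ Suc j * t * (X \<sigma> (fst P) - X \<sigma> (snd P)) - q j)"]
      show "exp (a j) \<le> (\<Sum>P\<in>\<Lambda> j. exp (2 ^ Suc j * t * (X \<sigma> (fst P) - X \<sigma> (snd P)) - q j))"
        by (simp add: a_def)
    qed auto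
    finally show ?thesis using A(2) by simp
  qed
  define V where "V = exp (10 * t\<^sup>2 * m)"
  have V1: "1 \<le> V" by (simp add: V_def)
  have level: "(\<Sum>\<sigma>\<in>Pow {..<m}. \<Sum>P\<in>\<Lambda> j. exp (2 ^ Suc j * t * (X \<sigma> (fst P) - X \<sigma> (snd P)) - q j))
      \<le> 2 ^ m * V" for j
  proof -
    have one: "(\<Sum>\<sigma>\<in>Pow {..<m}. exp (2 ^ Suc j * t * (X \<sigma> (fst P) - X \<sigma> (snd P)) - q j))
        \<le> exp (- q j) * (2 ^ m * V)" if "P \<in> \<Lambda> j" for P
    proof -
      obtain A where A: "A \<in> F" "P = (\<pi> (Suc j) A, \<pi> j A)" using \<open>P \<in> \<Lambda> j\<close> by (auto simp: \<Lambda>_def)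
      have finsd: "finite (sym_diff A (\<pi> i A))" for i
        using F(3)[OF A(1)] sub[OF A(1), of i] by (meson finite_Diff finite_UnI finite_lessThan finite_subset)
      have "card (sym_diff (fst P) (snd P)) \<le> card (sym_diff A (\<pi> (Suc j) A) \<union> sym_diff A (\<pi> j A))"
        using finsd by (intro card_mono) (auto simp: A(2))
      also have "\<dots> \<le> card (sym_diff A (\<pi> (Suc j) A)) + card (sym_diff A (\<pi> j A))"
        by (rule card_Un_le)
      finally have "real (card (sym_diff (fst P) (snd P))) \<le>
          (1/4) ^ Suc j * (2 * real m) + (1/4) ^ j * (2 * real m)"
        using dist[OF A(1), of j] dist[OF A(1), of "Suc j"] by linarith
      \<comment> \<open>The triangle inequality through \<open>A\<close> adds the radii of two
        consecutive levels, \<open>2 + 8 = 10\<close> in units of \<open>m / 4^(j+1)\<close>. The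
        squared scale \<open>4^(j+1)\<close> cancels the denominator, which leaves the same bound
        \<open>V\<close> at every level.\<close>
      also have "\<dots> = (1/4) ^ Suc j * (10 * m)" by simp
      finally have "(2 ^ Suc j * t)\<^sup>2 * card (sym_diff (fst P) (snd P))
          \<le> (2 ^ Suc j * t)\<^sup>2 * ((1/4) ^ Suc j * (10 * m))"
        by (intro mult_left_mono) auto
      also have "\<dots> = (4 ^ Suc j * (1/4) ^ Suc j) * (10 * t\<^sup>2 * m)"
      proof -
        have "(2 ^ Suc j :: real)\<^sup>2 = 4 ^ Suc j" by (simp add: power2_eq_square flip: power_mult_distrib)
        then show ?thesis by (simp only: power_mult_distrib) (simp add: algebra_simps)
      qed
      also have "(4 ^ Suc j * (1/4) ^ Suc j :: real) = 1" by (simp flip: power_mult_distrib)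
      finally have ex: "exp ((2 ^ Suc j * t)\<^sup>2 * card (sym_diff (fst P) (snd P))) \<le> V"
        by (simp add: V_def)
      have "(\<Sum>\<sigma>\<in>Pow {..<m}. exp (2 ^ Suc j * t * (X \<sigma> (fst P) - X \<sigma> (snd P)) - q j))
          = exp (- q j) * (\<Sum>\<sigma>\<in>Pow {..<m}. exp (2 ^ Suc j * t * (X \<sigma> (fst P) - X \<sigma> (snd P))))"
        by (simp add: sum_distrib_left flip: exp_add)
      also have "\<dots> \<le> exp (- q j) * (2 ^ m * exp ((2 ^ Suc j * t)\<^sup>2 * card (sym_diff (fst P) (snd P))))"
        unfolding X_def using sub[OF A(1)] A(2)
        by (intro mult_left_mono sum_exp_swap_dev_diff_le) auto
      also have "\<dots> \<le> exp (- q j) * (2 ^ m * V)"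
        using ex by (intro mult_left_mono) auto
      finally show ?thesis .
    qed
    have "(\<Sum>\<sigma>\<in>Pow {..<m}. \<Sum>P\<in>\<Lambda> j. exp (2 ^ Suc j * t * (X \<sigma> (fst P) - X \<sigma> (snd P)) - q j))
        = (\<Sum>P\<in>\<Lambda> j. \<Sum>\<sigma>\<in>Pow {..<m}. exp (2 ^ Suc j * t * (X \<sigma> (fst P) - X \<sigma> (snd P)) - q j))"
      by (rule sum.swap)
    also have "\<dots> \<le> card (\<Lambda> j) * (exp (- q j) * (2 ^ m * V))"
      using one by (rule sum_bounded_above)
    also have "\<dots> = (card (\<Lambda> j) * exp (- q j)) * (2 ^ m * V)" by simp
    also have "\<dots> \<le> 1 * (2 ^ m * V)"
      using V1 by (intro mult_right_mono card\<Lambda>) auto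
    finally show ?thesis by simp
  qed
  have "(\<Sum>\<sigma>\<in>Pow {..<m}. R \<sigma>) = (\<Sum>j<J. (1/2) ^ Suc j * (\<Sum>\<sigma>\<in>Pow {..<m}.
      \<Sum>P\<in>\<Lambda> j. exp (2 ^ Suc j * t * (X \<sigma> (fst P) - X \<sigma> (snd P)) - q j))) + 2 ^ m * (1/2) ^ J"
    unfolding R_def sum.distrib
    by (subst sum.swap) (simp add: sum_distrib_left card_Pow)
  also have "\<dots> \<le> (\<Sum>j<J. (1/2) ^ Suc j * (2 ^ m * V)) + 2 ^ m * V * (1/2) ^ J"
    using V1 by (intro add_mono sum_mono mult_left_mono level mult_right_mono) auto
  also have "\<dots> = (\<Sum>j<J. (1/2) ^ Suc j) * (2 ^ m * V) + 2 ^ m * V * (1/2) ^ J"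
    by (simp only: sum_distrib_right)
  also have "\<dots> = 2 ^ m * V"
    unfolding sum_dyadic_weights by (simp add: algebra_simps)
  finally have "exp Q * (\<Sum>\<sigma>\<in>Pow {..<m}. R \<sigma>) \<le> exp Q * (2 ^ m * V)" by simp
  moreover have "(\<Sum>\<sigma>\<in>Pow {..<m}. exp (t * (MAX A\<in>F. X \<sigma> A))) \<le> exp Q * (\<Sum>\<sigma>\<in>Pow {..<m}. R \<sigma>)"
    unfolding sum_distrib_left by (intro sum_mono pointwise)
  ultimately have "(\<Sum>\<sigma>\<in>Pow {..<m}. exp (t * (MAX A\<in>F. X \<sigma> A))) \<le> exp Q * (2 ^ m * V)" by linarith
  then show ?thesis
    by (simp add: X_def V_def Q_def L_def exp_add mult_ac)
qed

section \<open>Symmetrization and uniform deviations\<close>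

text \<open>Symmetrization: the ghost sample sits in the coordinates $m, \dots, 2m - 1$, and
  exchanging the coordinates $i$ and $m + i$ for $i \in \sigma$ preserves the product measure.\<close>
definition swap_index :: "nat \<Rightarrow> nat set \<Rightarrow> nat \<Rightarrow> nat" where
  "swap_index m \<sigma> i = (if i < m then (if i \<in> \<sigma> then m + i else i)
     else if i - m \<in> \<sigma> then i - m else i)"

lemma swap_index_in: "\<sigma> \<subseteq> {..<m} \<Longrightarrow> i < 2 * m \<Longrightarrow> swap_index m \<sigma> i < 2 * m"
  by (auto simp: swap_index_def)

lemma inj_on_swap_index: "\<sigma> \<subseteq> {..<m} \<Longrightarrow> inj_on (swap_index m \<sigma>) {..<2 * m}"
  by (rule inj_on_inverseI[of _ "swap_index m \<sigma>"]) (auto simp: swap_index_def)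

text \<open>The integral is unchanged by each of the \<open>2 ^ m\<close> coordinate swaps, so it
  equals the integral of their average. With the \<open>2 m\<close> points held fixed, that average
  is the finite sign sum handled by chaining.\<close>

lemma nn_integral_Max_symmetrized_le:
  fixes D :: "'a measure" and m :: nat and t :: real
  assumes D: "prob_space D" and m: "m \<ge> 1"
    and F: "finite F" "F \<noteq> {}" "F \<subseteq> sets D"
    and gr: "growth_bounded (space D) F K n" and nK: "n \<ge> 1" "K \<ge> 1"
  shows "(\<integral>\<^sup>+ w. ennreal (exp (t * (MAX A\<in>F. \<Sum>i<m. indicator A (w (m + i)) - indicator A (w i))))
            \<partial>(\<Pi>\<^sub>M i\<in>{..<2 * m}. D))
         \<le> ennreal (exp (12 * real n * ln (4 * real n * real K) + 10 * t\<^sup>2 * m))"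
proof -
  define P where "P = (\<Pi>\<^sub>M i\<in>{..<2 * m}. D)"
  interpret P: prob_space P unfolding P_def using D by (intro prob_space_PiM) auto
  define B where "B = exp (12 * real n * ln (4 * real n * real K) + 10 * t\<^sup>2 * m)"
  define \<Phi> where "\<Phi> w = exp (t * (MAX A\<in>F. \<Sum>i<m. indicator A (w (m + i)) - indicator A (w i)))"
    for w :: "nat \<Rightarrow> 'a"
  have [measurable]: "(\<lambda>w. indicator A (w i) :: real) \<in> borel_measurable P" if "A \<in> F" "i < 2 * m" for A i
  proof -
    have "(\<lambda>w. w i) \<in> measurable P D" unfolding P_def using that(2) by (intro measurable_component_singleton) simp
    then show ?thesis using that F(3) by (auto intro!: borel_measurable_indicator' measurable_compose[of _ P D])
  qed
  have \<Phi>[measurable]: "\<Phi> \<in> borel_measurable P"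
    unfolding \<Phi>_def using F by measurable
  define sw where "sw \<sigma> w = (\<lambda>i\<in>{..<2 * m}. w (swap_index m \<sigma> i))" for \<sigma> and w :: "nat \<Rightarrow> 'a"
  have distr: "distr P P (sw \<sigma>) = P" if "\<sigma> \<subseteq> {..<m}" for \<sigma>
    unfolding P_def sw_def using D swap_index_in[OF that] inj_on_swap_index[OF that]
    by (intro distr_PiM_reindex) auto
  have sw[measurable]: "sw \<sigma> \<in> measurable P P" if "\<sigma> \<subseteq> {..<m}" for \<sigma>
    unfolding P_def sw_def using swap_index_in[OF that]
    by (intro measurable_restrict measurable_component_singleton) simp
  have inv: "(\<integral>\<^sup>+ w. ennreal (\<Phi> (sw \<sigma> w)) \<partial>P) = (\<integral>\<^sup>+ w. ennreal (\<Phi> w) \<partial>P)" if "\<sigma> \<subseteq> {..<m}" for \<sigma>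
    using nn_integral_distr[OF sw[OF that], of "\<lambda>w. ennreal (\<Phi> w)"] distr[OF that] by simp
  \<comment> \<open>Events become sets of indices. A sequence of indices \<open>p\<close> pulls back
    to the sequence of points \<open>w (p s)\<close>, possibly with repetitions, so the growth bound
    carries over.\<close>
  define tr where "tr w = (\<lambda>A. {i \<in> {..<2 * m}. w i \<in> A})" for w :: "nat \<Rightarrow> 'a"
  have \<Phi>sw: "\<Phi> (sw \<sigma> w) = exp (t * (MAX A\<in>tr w ` F. swap_dev m \<sigma> A))" if "\<sigma> \<subseteq> {..<m}" for \<sigma> w
  proof -
    have "(\<Sum>i<m. indicator A (sw \<sigma> w (m + i)) - indicator A (sw \<sigma> w i)) = swap_dev m \<sigma> (tr w A)" for A
      unfolding swap_dev_def
      by (intro sum.cong refl) (auto simp: sw_def swap_index_def flip_sign_def tr_def indicator_def)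
    then show ?thesis by (simp add: \<Phi>_def image_image)
  qed
  have bound: "(\<Sum>\<sigma>\<in>Pow {..<m}. \<Phi> (sw \<sigma> w)) \<le> 2 ^ m * B" if w: "w \<in> space P" for w
  proof -
    have wD: "w i \<in> space D" if "i < 2 * m" for i using w that by (auto simp: P_def space_PiM)
    have "growth_bounded {..<2 * m} (tr w ` F) K n"
      unfolding growth_bounded_def
    proof (intro allI impI)
      fix l and p :: "nat \<Rightarrow> nat" assume p: "\<forall>s<l. p s \<in> {..<2 * m}"
      then have "trace_on l p (tr w A) = trace_on l (\<lambda>s. w (p s)) A" for A
        by (auto simp: trace_on_def tr_def)
      then have "trace_on l p ` tr w ` F = trace_on l (\<lambda>s. w (p s)) ` F"
        by (simp add: image_image)
      then show "card (trace_on l p ` tr w ` F) \<le> (l * K + 1) ^ n"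
        using gr p wD unfolding growth_bounded_def by auto
    qed
    then have "(\<Sum>\<sigma>\<in>Pow {..<m}. exp (t * (MAX A\<in>tr w ` F. swap_dev m \<sigma> A))) \<le> 2 ^ m * B"
      unfolding B_def using F m nK by (intro sum_exp_Max_swap_dev_le) (auto simp: tr_def)
    then show ?thesis using \<Phi>sw by simp
  qed
  have "2 ^ m * (\<integral>\<^sup>+ w. ennreal (\<Phi> w) \<partial>P) = (\<Sum>\<sigma>\<in>Pow {..<m}. \<integral>\<^sup>+ w. ennreal (\<Phi> (sw \<sigma> w)) \<partial>P)"
    by (simp add: inv card_Pow)
  also have "\<dots> = (\<integral>\<^sup>+ w. (\<Sum>\<sigma>\<in>Pow {..<m}. ennreal (\<Phi> (sw \<sigma> w))) \<partial>P)"
    by (intro nn_integral_sum[symmetric]) (auto intro!: measurable_compose[OF sw] measurable_compose[OF \<Phi>])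
  also have "\<dots> = (\<integral>\<^sup>+ w. ennreal (\<Sum>\<sigma>\<in>Pow {..<m}. \<Phi> (sw \<sigma> w)) \<partial>P)"
    by (intro nn_integral_cong sum_ennreal) (simp add: \<Phi>_def)
  also have "\<dots> \<le> (\<integral>\<^sup>+ w. ennreal (2 ^ m * B) \<partial>P)"
    by (intro nn_integral_mono ennreal_leI bound)
  also have "\<dots> = 2 ^ m * ennreal B"
    by (simp add: P.emeasure_space_1 ennreal_mult B_def flip: ennreal_power)
  finally have "2 ^ m * (\<integral>\<^sup>+ w. ennreal (\<Phi> w) \<partial>P) \<le> 2 ^ m * ennreal B" .
  then have "(\<integral>\<^sup>+ w. ennreal (\<Phi> w) \<partial>P) \<le> ennreal B"
    by (subst (asm) ennreal_mult_le_mult_iff) (auto simp: power_eq_top_ennreal)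
  then show ?thesis by (simp add: P_def \<Phi>_def B_def)
qed

text \<open>Jensen's inequality with a nonnegative integral on the right, which may be infinite.
  \<open>g\<close> is the tangent line at the mean, so only \<open>Z\<close> itself has to be
  integrable.\<close>

lemma exp_expectation_le_nn_integral:
  assumes M: "prob_space M" and Z: "integrable M Z"
  shows "ennreal (exp (t * (\<integral>x. Z x \<partial>M))) \<le> (\<integral>\<^sup>+ x. ennreal (exp (t * Z x)) \<partial>M)"
proof -
  interpret prob_space M by (rule M)
  define \<mu> where "\<mu> = (\<integral>x. Z x \<partial>M)"
  define g where "g x = exp (t * \<mu>) * (1 + t * (Z x - \<mu>))" for x
  have g: "integrable M g" unfolding g_def using Z by auto
  have "(\<integral>x. g x \<partial>M) = exp (t * \<mu>)"
    unfolding g_def using Z by (simp add: prob_space \<mu>_def)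
  then have "ennreal (exp (t * \<mu>)) = ennreal (\<integral>x. g x \<partial>M)" by simp
  also have "\<dots> \<le> (\<integral>\<^sup>+ x. ennreal (g x) \<partial>M)"
  proof -
    have "(\<integral>x. g x \<partial>M) \<le> (\<integral>x. max 0 (g x) \<partial>M)"
      using g by (intro integral_mono) auto
    also have "ennreal (\<integral>x. max 0 (g x) \<partial>M) = (\<integral>\<^sup>+ x. ennreal (max 0 (g x)) \<partial>M)"
      using g by (intro nn_integral_eq_integral[symmetric]) auto
    finally show ?thesis by (simp add: ennreal_leI ennreal_max_0 max.commute)
  qed
  also have "\<dots> \<le> (\<integral>\<^sup>+ x. ennreal (exp (t * Z x)) \<partial>M)"
  proof (intro nn_integral_mono ennreal_leI)
    fix x
    have "g x \<le> exp (t * \<mu>) * exp (t * (Z x - \<mu>))"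
      unfolding g_def using exp_ge_add_one_self by (intro mult_left_mono) auto
    then show "g x \<le> exp (t * Z x)" by (simp add: algebra_simps flip: exp_add)
  qed
  finally show ?thesis by (simp add: \<mu>_def)
qed

text \<open>On the bad event some \<open>A\<close> deviates by more than \<open>a\<close>. As
  \<open>measure D A\<close> is the ghost mean of the indicator, Jensen makes the ghost integral of
  \<open>exp (t * (max - a))\<close> at least \<open>1\<close>. Integrating over the sample is then
  Markov's inequality, and Fubini merges both samples.\<close>

lemma uniform_deviation_finite:
  fixes D :: "'a measure" and m :: nat and a t :: real
  assumes D: "prob_space D" and m: "m \<ge> 1"
    and F: "finite F" "F \<noteq> {}" "F \<subseteq> sets D"
    and gr: "growth_bounded (space D) F K n" and nK: "n \<ge> 1" "K \<ge> 1" and t: "t \<ge> 0"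
  defines "P \<equiv> \<Pi>\<^sub>M i\<in>{..<m}. D"
  shows "measure P {S \<in> space P. \<exists>A\<in>F. a < (\<Sum>i<m. measure D A - indicator A (S i))}
     \<le> exp (12 * real n * ln (4 * real n * real K) + 10 * t\<^sup>2 * m - t * a)"
proof -
  interpret D: prob_space D by (rule D)
  interpret prod: product_sigma_finite "\<lambda>_::nat. D" ..
  interpret P: prob_space P unfolding P_def using D by (intro prob_space_PiM) auto
  \<comment> \<open>The ghost sample is indexed by \<open>{m..<2 * m}\<close>, so that merging it
    with \<open>P\<close> gives the product over \<open>{..<2 * m}\<close> directly.\<close>
  define P' where "P' = (\<Pi>\<^sub>M i\<in>{m..<2 * m}. D)"
  define PP where "PP = (\<Pi>\<^sub>M i\<in>{..<2 * m}. D)"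
  interpret P': prob_space P' unfolding P'_def using D by (intro prob_space_PiM) auto
  define mrg where "mrg S y = merge {..<m} {m..<2 * m} (S, y)" for S y :: "nat \<Rightarrow> 'a"
  define \<Phi> where "\<Phi> w = exp (t * (MAX A\<in>F. \<Sum>i<m. indicator A (w (m + i)) - indicator A (w i)))"
    for w :: "nat \<Rightarrow> 'a"
  define Bad where "Bad = {S \<in> space P. \<exists>A\<in>F. a < (\<Sum>i<m. measure D A - indicator A (S i))}"
  have ind: "(\<lambda>w. indicator A (w i) :: real) \<in> borel_measurable (\<Pi>\<^sub>M i\<in>I. D)"
    if "A \<in> F" "i \<in> I" for A i and I :: "nat set"
  proof -
    have "(\<lambda>w. w i) \<in> measurable (\<Pi>\<^sub>M i\<in>I. D) D" using that(2) by (rule measurable_component_singleton)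
    then show ?thesis
      using that F(3) by (auto intro!: borel_measurable_indicator' measurable_compose[of _ _ D])
  qed
  have [measurable]: "(\<lambda>w. indicator A (w i) :: real) \<in> borel_measurable PP" if "A \<in> F" "i < 2 * m" for A i
    unfolding PP_def using that by (intro ind) auto
  have \<Phi>[measurable]: "\<Phi> \<in> borel_measurable PP"
    unfolding \<Phi>_def using F by measurable
  have Bad: "Bad \<in> sets P"
  proof -
    have "Bad = (\<Union>A\<in>F. {S \<in> space P. a < (\<Sum>i<m. measure D A - indicator A (S i))})"
      by (auto simp: Bad_def)
    moreover have "{S \<in> space P. a < (\<Sum>i<m. measure D A - indicator A (S i))} \<in> sets P" if "A \<in> F" for A
    proof -
      have "(\<lambda>S. \<Sum>i<m. measure D A - indicator A (S i)) \<in> borel_measurable P"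
        unfolding P_def using that by (intro borel_measurable_sum borel_measurable_diff ind) auto
      then show ?thesis by measurable
    qed
    ultimately show ?thesis using F(1) by auto
  qed
  have ghost: "ennreal 1 \<le> (\<integral>\<^sup>+ y. ennreal (exp (- (t * a)) * \<Phi> (mrg S y)) \<partial>P')" if S: "S \<in> Bad" for S
  proof -
    obtain A where A: "A \<in> F" "a < (\<Sum>i<m. measure D A - indicator A (S i))"
      using S by (auto simp: Bad_def)
    define Z where "Z y = (\<Sum>i<m. indicator A (y (m + i)) - indicator A (S i)) - a" for y :: "nat \<Rightarrow> 'a"
    have int: "integrable P' (\<lambda>y. indicator A (y (m + i)) :: real)" if "i < m" for i
      unfolding P'_def using that A(1)
      by (intro P'.integrable_const_bound[of _ 1, unfolded P'_def] ind) (auto simp: indicator_def)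
    have comp: "(\<integral>y. indicator A (y (m + i)) \<partial>P') = measure D A" if "i < m" for i
    proof -
      have "(\<integral>y. (indicator A (y (m + i)) :: real) \<partial>P') = (\<integral>z. indicator A z \<partial>(distr P' D (\<lambda>y. y (m + i))))"
        unfolding P'_def using that A(1) F(3)
        by (intro integral_distr[symmetric] measurable_component_singleton) auto
      also have "distr P' D (\<lambda>y. y (m + i)) = D"
        unfolding P'_def using that D by (intro distr_PiM_component) auto
      finally show ?thesis using A(1) F(3) by auto
    qed
    have intZ: "integrable P' Z" unfolding Z_def using int
      by (intro Bochner_Integration.integrable_diff Bochner_Integration.integrable_sum) auto
    have "(\<integral>y. Z y \<partial>P') = (\<Sum>i<m. measure D A - indicator A (S i)) - a"
    proof -
      have "(\<integral>y. Z y \<partial>P') = (\<integral>y. (\<Sum>i<m. indicator A (y (m + i)) - indicator A (S i) :: real) \<partial>P') - (\<integral>y. a \<partial>P')"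
        unfolding Z_def using int
        by (intro Bochner_Integration.integral_diff Bochner_Integration.integrable_diff
              Bochner_Integration.integrable_sum) auto
      also have "(\<integral>y. (\<Sum>i<m. indicator A (y (m + i)) - indicator A (S i) :: real) \<partial>P')
          = (\<Sum>i<m. \<integral>y. (indicator A (y (m + i)) - indicator A (S i)) \<partial>P')"
        using int by (intro Bochner_Integration.integral_sum Bochner_Integration.integrable_diff) auto
      also have "\<dots> = (\<Sum>i<m. measure D A - indicator A (S i))"
        using int comp by (intro sum.cong refl) (simp add: P'.prob_space)
      finally show ?thesis by (simp add: P'.prob_space)
    qed
    then have "ennreal 1 \<le> ennreal (exp (t * (\<integral>y. Z y \<partial>P')))"
      using A(2) t by (intro ennreal_leI) (simp add: mult_nonneg_nonneg)
    also have "\<dots> \<le> (\<integral>\<^sup>+ y. ennreal (exp (t * Z y)) \<partial>P')"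
      by (rule exp_expectation_le_nn_integral[OF P'.prob_space_axioms intZ])
    also have "\<dots> \<le> (\<integral>\<^sup>+ y. ennreal (exp (- (t * a)) * \<Phi> (mrg S y)) \<partial>P')"
    proof (intro nn_integral_mono ennreal_leI)
      fix y
      have "(\<Sum>i<m. indicator A (y (m + i)) - indicator A (S i))
          = (\<Sum>i<m. indicator A (mrg S y (m + i)) - indicator A (mrg S y i) :: real)"
        by (intro sum.cong refl) (auto simp: mrg_def merge_def)
      also have "\<dots> \<le> (MAX A\<in>F. \<Sum>i<m. indicator A (mrg S y (m + i)) - indicator A (mrg S y i))"
        using F(1) A(1) by (intro Max_ge) auto
      finally have "t * Z y \<le> - (t * a) +
          t * (MAX A\<in>F. \<Sum>i<m. indicator A (mrg S y (m + i)) - indicator A (mrg S y i))"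
        unfolding Z_def right_diff_distrib using t by (simp add: mult_left_mono)
      then show "exp (t * Z y) \<le> exp (- (t * a)) * \<Phi> (mrg S y)"
        unfolding \<Phi>_def by (simp flip: exp_add)
    qed
    finally show ?thesis .
  qed
  have un: "{..<m} \<union> {m..<2 * m} = {..<2 * m}" using m by auto
  have "emeasure P Bad = (\<integral>\<^sup>+ S. indicator Bad S \<partial>P)" using Bad by simp
  also have "\<dots> \<le> (\<integral>\<^sup>+ S. \<integral>\<^sup>+ y. ennreal (exp (- (t * a)) * \<Phi> (mrg S y)) \<partial>P' \<partial>P)"
    using ghost by (intro nn_integral_mono) (auto simp: indicator_def)
  also have "\<dots> = (\<integral>\<^sup>+ w. ennreal (exp (- (t * a)) * \<Phi> w) \<partial>PP)"
    using prod.product_nn_integral_fold[of "{..<m}" "{m..<2 * m}" "\<lambda>w. ennreal (exp (- (t * a)) * \<Phi> w)"] \<Phi>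
    unfolding P_def P'_def PP_def mrg_def un by (simp add: ivl_disj_int)
  also have "\<dots> = ennreal (exp (- (t * a))) * (\<integral>\<^sup>+ w. ennreal (\<Phi> w) \<partial>PP)"
  proof -
    have "ennreal (exp (- (t * a)) * \<Phi> w) = ennreal (exp (- (t * a))) * ennreal (\<Phi> w)" for w
      by (rule ennreal_mult) (simp_all add: \<Phi>_def)
    then show ?thesis by (simp add: nn_integral_cmult)
  qed
  also have "\<dots> \<le> ennreal (exp (- (t * a))) *
      ennreal (exp (12 * real n * ln (4 * real n * real K) + 10 * t\<^sup>2 * m))"
    unfolding \<Phi>_def PP_def by (intro mult_left_mono nn_integral_Max_symmetrized_le[OF D m F gr nK]) auto
  also have "\<dots> = ennreal (exp (12 * real n * ln (4 * real n * real K) + 10 * t\<^sup>2 * m - t * a))"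
    by (simp add: ennreal_mult[symmetric] algebra_simps flip: exp_add)
  finally show ?thesis
    unfolding Bad_def[symmetric] by (simp add: P.emeasure_eq_measure)
qed

lemma uniform_deviation_sequence:
  fixes D :: "'a measure" and m :: nat and A :: "nat \<Rightarrow> 'a set" and u \<delta> :: real
  assumes D: "prob_space D" and m: "m \<ge> 1" and A: "range A \<subseteq> sets D"
    and gr: "growth_bounded (space D) (range A) K n" and nK: "n \<ge> 1" "K \<ge> 1"
    and \<delta>: "\<delta> > 0" and u: "u \<ge> 0"
    and mu: "40 * (12 * real n * ln (4 * real n * real K) + ln (1 / \<delta>)) \<le> m * u\<^sup>2"
  defines "P \<equiv> \<Pi>\<^sub>M i\<in>{..<m}. D"
  defines "Bad \<equiv> {S \<in> space P. \<exists>q. m * u < (\<Sum>i<m. measure D (A q) - indicator (A q) (S i))}"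
  shows "Bad \<in> sets P" "measure P Bad \<le> \<delta>"
proof -
  interpret P: prob_space P unfolding P_def using D by (intro prob_space_PiM) auto
  define B where "B q = {S \<in> space P. \<exists>E\<in>A ` {..q}. m * u < (\<Sum>i<m. measure D E - indicator E (S i))}" for q
  have single: "{S \<in> space P. m * u < (\<Sum>i<m. measure D (A q) - indicator (A q) (S i))} \<in> sets P" for q
  proof -
    have "(\<lambda>S. indicator (A q) (S i) :: real) \<in> borel_measurable P" if "i < m" for i
    proof -
      have "(\<lambda>S. S i) \<in> measurable P D"
        unfolding P_def using that by (intro measurable_component_singleton) simp
      then show ?thesis using A by (auto intro!: borel_measurable_indicator' measurable_compose[of _ _ D])
    qed
    then have "(\<lambda>S. \<Sum>i<m. measure D (A q) - indicator (A q) (S i)) \<in> borel_measurable P"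
      by (intro borel_measurable_sum borel_measurable_diff) auto
    then show ?thesis by measurable
  qed
  have "B q = (\<Union>j\<le>q. {S \<in> space P. m * u < (\<Sum>i<m. measure D (A j) - indicator (A j) (S i))})" for q
    by (auto simp: B_def)
  then have B: "B q \<in> sets P" for q using single by auto
  have inc: "incseq B" by (rule incseq_SucI) (auto simp: B_def)
  have Un: "Bad = (\<Union>q. B q)" unfolding Bad_def B_def by auto
  show "Bad \<in> sets P" unfolding Un using B by auto
  have "measure P (B q) \<le> \<delta>" for q
  proof -
    \<comment> \<open>The choice \<open>t = u / 20\<close> minimizes
      \<open>10 t^2 m - t m u\<close>; the minimum \<open>- m u^2 / 40\<close> explains the factor
      \<open>40\<close> in the assumption.\<close>
    have "measure P (B q) \<le> exp (12 * real n * ln (4 * real n * real K) + 10 * (u / 20)\<^sup>2 * m - u / 20 * (m * u))"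
      unfolding B_def P_def using A u
      by (intro uniform_deviation_finite[OF D m _ _ _ growth_bounded_mono[OF gr order_refl] nK]) auto
    also have "12 * real n * ln (4 * real n * real K) + 10 * (u / 20)\<^sup>2 * m - u / 20 * (m * u)
        = 12 * real n * ln (4 * real n * real K) - m * u\<^sup>2 / 40"
      by (simp add: power2_eq_square)
    also have "\<dots> \<le> ln \<delta>" using mu \<delta> by (simp add: ln_div)
    finally show ?thesis using \<delta> by simp
  qed
  moreover have "(\<lambda>q. measure P (B q)) \<longlonglongrightarrow> measure P Bad"
    unfolding Un using B inc by (intro P.finite_Lim_measure_incseq) auto
  ultimately show "measure P Bad \<le> \<delta>" by (intro LIMSEQ_le_const2) auto
qed

section \<open>Predictors with a tie tolerance\<close>

definition near_argmax :: "nat \<Rightarrow> nat \<Rightarrow> mat \<Rightarrow> real \<Rightarrow> (nat \<Rightarrow> real) \<Rightarrow> nat set" where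
  "near_argmax d k V e x = {j \<in> {1..k}. \<forall>j'\<in>{1..k}. score d V x j' \<le> score d V x j + e}"

definition err_set :: "example measure \<Rightarrow> (nat set \<Rightarrow> nat) \<Rightarrow> nat \<Rightarrow> nat \<Rightarrow> mat \<Rightarrow> real \<Rightarrow> example set" where
  "err_set D tb d k V e = {z \<in> space D. tb (near_argmax d k V e (fst z)) \<noteq> snd z}"

lemma predict_eq_near_argmax: "predict tb d k W x = tb (near_argmax d k W 0 x)"
  by (simp add: predict_def near_argmax_def)

text \<open>The tie-breaking rule is an arbitrary function of a label set, but it is evaluated only
  at the finitely many subsets of \<open>{1..k}\<close>, and each of these is selected by finitely
  many linear inequalities.\<close>

lemma err_set_measurable:
  assumes D: "sets D = sets (example_space d)"
  shows "err_set D tb d k V e \<in> sets D"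
proof -
  have D': "sets D = sets ((\<Pi>\<^sub>M r\<in>{1..d}. borel) \<Otimes>\<^sub>M count_space UNIV)"
    using D unfolding example_space_def .
  have fst: "fst \<in> measurable D (\<Pi>\<^sub>M r\<in>{1..d}. (borel :: real measure))"
    by (subst measurable_cong_sets[OF D' refl]) simp
  have snd[measurable]: "snd \<in> measurable D (count_space UNIV)"
    by (subst measurable_cong_sets[OF D' refl]) simp
  have "(\<lambda>z. fst z r) \<in> borel_measurable D" if "r \<in> {1..d}" for r
    using measurable_compose[OF fst measurable_component_singleton[OF that]] by simp
  then have [measurable]: "(\<lambda>z. score d V (fst z) j) \<in> borel_measurable D" for j
    unfolding score_def by (intro borel_measurable_sum borel_measurable_times) auto
  have "err_set D tb d k V e = {z \<in> space D. \<exists>A\<in>Pow {1..k}.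
      (\<forall>j\<in>{1..k}. j \<in> A \<longleftrightarrow> (\<forall>j'\<in>{1..k}. score d V (fst z) j' \<le> score d V (fst z) j + e)) \<and> tb A \<noteq> snd z}"
  proof -
    have "near_argmax d k V e x = A \<longleftrightarrow> (\<forall>j\<in>{1..k}. j \<in> A \<longleftrightarrow> (\<forall>j'\<in>{1..k}. score d V x j' \<le> score d V x j + e))"
      if "A \<in> Pow {1..k}" for A x
      using that by (auto simp: near_argmax_def)
    moreover have "near_argmax d k V e x \<in> Pow {1..k}" for x by (auto simp: near_argmax_def)
    ultimately have "tb (near_argmax d k V e x) \<noteq> y \<longleftrightarrow> (\<exists>A\<in>Pow {1..k}.
        (\<forall>j\<in>{1..k}. j \<in> A \<longleftrightarrow> (\<forall>j'\<in>{1..k}. score d V x j' \<le> score d V x j + e)) \<and> tb A \<noteq> y)" for x y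
      by metis
    then show ?thesis unfolding err_set_def by simp
  qed
  also have "\<dots> \<in> sets D" by measurable
  finally show ?thesis .
qed

lemma score_supported_on:
  assumes "V \<in> supported_on d k I" "I \<subseteq> {1..d}"
  shows "score d V x j = (\<Sum>r\<in>I. V j r * x r)"
  unfolding score_def using assms
  by (intro sum.mono_neutral_right) (auto simp: supported_on_def)

text \<open>The comparison of labels \<open>j\<close> and \<open>j'\<close> on example
  \<open>s\<close> is the sign of a functional linear in the weights and the tolerance jointly. Its
  signs fix the set handed to \<open>tb\<close>, hence the error, whatever \<open>tb\<close>
  does.\<close>

lemma growth_bounded_err_sets:
  assumes I: "I \<subseteq> {1..d}" and G: "G \<subseteq> supported_on d k I \<times> UNIV"
  shows "growth_bounded U ((\<lambda>(V, e). err_set D tb d k V e) ` G) (k * k) (k * card I + 1)"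
  unfolding growth_bounded_def
proof (intro allI impI)
  fix l and p :: "nat \<Rightarrow> example"
  have finI: "finite I" using I by (rule finite_subset) simp
  \<comment> \<open>Index set of the parameters: \<open>Some (a, r)\<close> is a weight and
    \<open>None\<close> the tolerance, whose coefficient is always \<open>1\<close>.\<close>
  define J where "J = insert None (Some ` ({1..k} \<times> I))"
  define X where "X = {..<l :: nat} \<times> {1..k} \<times> {1..k}"
  define b where "b u i = (case i of (s, j, j') \<Rightarrow> (case u of None \<Rightarrow> 1
    | Some (a, r) \<Rightarrow> (if a = j then fst (p s) r else 0) - (if a = j' then fst (p s) r else 0)))"
    for u :: "(nat \<times> nat) option" and i :: "nat \<times> nat \<times> nat"
  define pat where "pat c = {i \<in> X. 0 \<le> (\<Sum>u\<in>J. c u * b u i)}" for c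
  \<comment> \<open>\<open>\<Psi>\<close> rebuilds the error trace from the sign pattern alone, so
    there are no more traces than patterns.\<close>
  define \<Psi> where "\<Psi> A = {s. s < l \<and> p s \<in> space D \<and>
      tb {j \<in> {1..k}. \<forall>j'\<in>{1..k}. (s, j, j') \<in> A} \<noteq> snd (p s)}" for A
  have "trace_on l p (err_set D tb d k V e) \<in> \<Psi> ` range pat" if V: "V \<in> supported_on d k I" for V e
  proof -
    define c where "c u = (case u of None \<Rightarrow> e | Some (a, r) \<Rightarrow> V a r)" for u
    have lin: "(\<Sum>u\<in>J. c u * b u (s, j, j')) = e + score d V (fst (p s)) j - score d V (fst (p s)) j'"
      if "j \<in> {1..k}" "j' \<in> {1..k}" for s j j'
    proof -
      have pick: "(\<Sum>a\<in>{1..k}. \<Sum>r\<in>I. V a r * (if a = h then fst (p s) r else 0)) = score d V (fst (p s)) h"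
        if "h \<in> {1..k}" for h
      proof -
        have "(\<Sum>a\<in>{1..k}. \<Sum>r\<in>I. V a r * (if a = h then fst (p s) r else 0))
            = (\<Sum>a\<in>{1..k}. if a = h then \<Sum>r\<in>I. V a r * fst (p s) r else 0)"
          by (intro sum.cong) auto
        then show ?thesis using that by (simp add: score_supported_on[OF V I])
      qed
      have "(\<Sum>u\<in>J. c u * b u (s, j, j')) = e + (\<Sum>u\<in>{1..k} \<times> I. c (Some u) * b (Some u) (s, j, j'))"
        unfolding J_def using finI by (subst sum.insert) (auto simp: c_def b_def sum.reindex)
      also have "(\<Sum>u\<in>{1..k} \<times> I. c (Some u) * b (Some u) (s, j, j'))
          = (\<Sum>a\<in>{1..k}. \<Sum>r\<in>I. V a r * (if a = j then fst (p s) r else 0)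
              - V a r * (if a = j' then fst (p s) r else 0))"
        unfolding sum.cartesian_product
        by (intro sum.cong refl) (auto simp: c_def b_def algebra_simps)
      also have "\<dots> = score d V (fst (p s)) j - score d V (fst (p s)) j'"
        by (simp only: sum_subtractf pick[OF that(1)] pick[OF that(2)])
      finally show ?thesis by simp
    qed
    have "(s, j, j') \<in> pat c \<longleftrightarrow> score d V (fst (p s)) j' \<le> score d V (fst (p s)) j + e"
      if "s < l" "j \<in> {1..k}" "j' \<in> {1..k}" for s j j'
      using that lin[OF that(2,3), of s] by (auto simp: pat_def X_def)
    then have "{j \<in> {1..k}. \<forall>j'\<in>{1..k}. (s, j, j') \<in> pat c} = near_argmax d k V e (fst (p s))" if "s < l" for s
      using that unfolding near_argmax_def by blast
    then have "\<Psi> (pat c) = trace_on l p (err_set D tb d k V e)"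
      unfolding \<Psi>_def trace_on_def err_set_def by auto
    then show ?thesis by (metis rangeI image_eqI)
  qed
  then have sub: "trace_on l p ` (\<lambda>(V, e). err_set D tb d k V e) ` G \<subseteq> \<Psi> ` range pat"
    using G by auto
  have fin: "finite (range pat)"
    by (rule finite_subset[of _ "Pow X"]) (auto simp: pat_def X_def)
  have "card (trace_on l p ` (\<lambda>(V, e). err_set D tb d k V e) ` G) \<le> card (range pat)"
    using sub fin by (meson card_image_le card_mono finite_imageI le_trans)
  also have "\<dots> \<le> (card X + 1) ^ card J"
    unfolding pat_def using finI by (intro card_linear_sign_patterns_le) (auto simp: X_def J_def)
  also have "card X = l * (k * k)" by (simp add: X_def card_cartesian_product)
  also have "card J = k * card I + 1"
    unfolding J_def using finI by (subst card_insert_disjoint) (auto simp: card_image card_cartesian_product)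
  finally show "card (trace_on l p ` (\<lambda>(V, e). err_set D tb d k V e) ` G) \<le> (l * (k * k) + 1) ^ (k * card I + 1)" .
qed

text \<open>Extensional functions on the finite index set make countability immediate; they are then
  padded with \<open>0\<close> to give matrices supported on \<open>I\<close>.\<close>

definition rational_params :: "nat \<Rightarrow> nat set \<Rightarrow> (mat \<times> real) set" where
  "rational_params k I = (\<lambda>(f, e). (\<lambda>j r. if (j, r) \<in> {1..k} \<times> I then f (j, r) else 0, e)) `
     (PiE ({1..k} \<times> I) (\<lambda>_. \<rat>) \<times> \<rat>)"

lemma countable_rational_params: "finite I \<Longrightarrow> countable (rational_params k I)"
  unfolding rational_params_def
  by (intro countable_image countable_SIGMA countable_PiE) (auto simp: countable_rat)

lemma rational_params_subset: "I \<subseteq> {1..d} \<Longrightarrow> rational_params k I \<subseteq> supported_on d k I \<times> UNIV"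
  by (auto simp: rational_params_def supported_on_def)

text \<open>The tie tolerance $1/(q+1)$ dominates the rounding error $O(1/(q+1)^2)$, so exact ties
  survive the rounding while every strict inequality is eventually respected. Without the
  tolerance, predictors with irrational weights need not be pointwise limits of rational ones.\<close>
lemma rational_approximation:
  assumes W: "W \<in> supported_on d k I" and I: "I \<subseteq> {1..d}"
  obtains V where "\<And>q. (V q, 1 / real (Suc q)) \<in> rational_params k I"
    and "\<And>x. eventually (\<lambda>q. near_argmax d k (V q) (1 / real (Suc q)) x = near_argmax d k W 0 x) sequentially"
proof -
  define \<epsilon> where "\<epsilon> q = 1 / real (Suc q)" for q
  have \<epsilon>0: "\<epsilon> q > 0" for q by (simp add: \<epsilon>_def)
  have \<epsilon>lim: "\<epsilon> \<longlonglongrightarrow> 0" unfolding \<epsilon>_def using LIMSEQ_inverse_real_of_nat by (simp add: inverse_eq_divide)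
  have "\<exists>y\<in>\<rat>. \<bar>y - W j r\<bar> \<le> (\<epsilon> q)\<^sup>2" for q j r
  proof -
    have "W j r - (\<epsilon> q)\<^sup>2 < W j r" using \<epsilon>0[of q] by simp
    then obtain y where "y \<in> \<rat>" "W j r - (\<epsilon> q)\<^sup>2 < y" "y < W j r" using Rats_dense_in_real by blast
    then show ?thesis by (intro bexI[of _ y]) auto
  qed
  then have ex: "\<exists>y. y \<in> \<rat> \<and> \<bar>y - W j r\<bar> \<le> (\<epsilon> q)\<^sup>2" for q j r by blast
  define R where "R q j r = (SOME y. y \<in> \<rat> \<and> \<bar>y - W j r\<bar> \<le> (\<epsilon> q)\<^sup>2)" for q j r
  have R: "R q j r \<in> \<rat>" "\<bar>R q j r - W j r\<bar> \<le> (\<epsilon> q)\<^sup>2" for q j r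
    using someI_ex[OF ex[of j r q]] by (simp_all add: R_def)
  define V where "V q j r = (if (j, r) \<in> {1..k} \<times> I then R q j r else 0)" for q j r
  have mem: "(V q, \<epsilon> q) \<in> rational_params k I" for q
    unfolding rational_params_def
  proof (rule image_eqI[of _ _ "(restrict (\<lambda>(j, r). R q j r) ({1..k} \<times> I), \<epsilon> q)"])
    show "(restrict (\<lambda>(j, r). R q j r) ({1..k} \<times> I), \<epsilon> q) \<in> PiE ({1..k} \<times> I) (\<lambda>_. \<rat>) \<times> \<rat>"
      using R(1) by (auto simp: \<epsilon>_def)
  qed (auto simp: V_def fun_eq_iff)
  have close: "\<bar>V q j r - W j r\<bar> \<le> (\<epsilon> q)\<^sup>2" for q j r
    using R(2) W I by (auto simp: V_def supported_on_def)
  have conv: "eventually (\<lambda>q. near_argmax d k (V q) (\<epsilon> q) x = near_argmax d k W 0 x) sequentially" for x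
  proof -
    \<comment> \<open>The rounding error of a score scales with the l1 norm of \<open>x\<close>, so
      the index from which the label sets agree depends on \<open>x\<close>. Pointwise convergence
      is all that dominated convergence needs.\<close>
    define c where "c = (\<Sum>r\<in>{1..d}. \<bar>x r\<bar>)"
    have c0: "0 \<le> c" by (simp add: c_def sum_nonneg)
    have sc: "\<bar>score d (V q) x j - score d W x j\<bar> \<le> c * (\<epsilon> q)\<^sup>2" for q j
    proof -
      have "\<bar>score d (V q) x j - score d W x j\<bar> = \<bar>\<Sum>r\<in>{1..d}. (V q j r - W j r) * x r\<bar>"
        by (simp add: score_def left_diff_distrib sum_subtractf)
      also have "\<dots> \<le> (\<Sum>r\<in>{1..d}. (\<epsilon> q)\<^sup>2 * \<bar>x r\<bar>)"
        using close by (intro order_trans[OF sum_abs] sum_mono) (simp add: abs_mult mult_right_mono)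
      finally show ?thesis by (simp add: c_def sum_distrib_left mult.commute)
    qed
    have small: "eventually (\<lambda>q. 2 * c * \<epsilon> q < 1) sequentially"
    proof -
      have "(\<lambda>q. 2 * c * \<epsilon> q) \<longlonglongrightarrow> 2 * c * 0" by (intro tendsto_mult \<epsilon>lim tendsto_const)
      then show ?thesis by (intro order_tendstoD(2)[of _ 0]) auto
    qed
    have "eventually (\<lambda>q. (score d (V q) x j' \<le> score d (V q) x j + \<epsilon> q) = (score d W x j' \<le> score d W x j))
        sequentially" for j j'
    proof (cases "score d W x j' \<le> score d W x j")
      case True
      show ?thesis using small
      proof eventually_elim
        case (elim q)
        have "2 * (c * (\<epsilon> q)\<^sup>2) = (2 * c * \<epsilon> q) * \<epsilon> q" by (simp add: power2_eq_square)
        also have "\<dots> \<le> 1 * \<epsilon> q" using elim \<epsilon>0[of q] by (intro mult_right_mono) auto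
        finally show ?case using sc[of q j] sc[of q j'] True by auto
      qed
    next
      case False
      have "(\<lambda>q. 2 * (c * (\<epsilon> q)\<^sup>2) + \<epsilon> q) \<longlonglongrightarrow> 2 * (c * 0\<^sup>2) + 0"
        by (intro tendsto_intros \<epsilon>lim)
      then have "eventually (\<lambda>q. 2 * (c * (\<epsilon> q)\<^sup>2) + \<epsilon> q < score d W x j' - score d W x j) sequentially"
        using False by (intro order_tendstoD(2)) auto
      then show ?thesis
      proof eventually_elim
        case (elim q)
        then show ?case using sc[of q j] sc[of q j'] False by auto
      qed
    qed
    then have "eventually (\<lambda>q. \<forall>j\<in>{1..k}. \<forall>j'\<in>{1..k}.
        (score d (V q) x j' \<le> score d (V q) x j + \<epsilon> q) = (score d W x j' \<le> score d W x j)) sequentially"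
      by (intro eventually_ball_finite ballI) auto
    then show ?thesis
      by eventually_elim (auto simp: near_argmax_def)
  qed
  show ?thesis using mem conv by (intro that[of V]) (auto simp: \<epsilon>_def)
qed

text \<open>The deviation of the error set of \<open>W\<close> is a limit of rational ones: the
  measures converge by dominated convergence, and the empirical part because it involves only
  \<open>m\<close> points.\<close>

lemma pop_error_le_of_rational_params:
  assumes D: "prob_space D" "sets D = sets (example_space d)" and m: "m \<ge> 1"
    and S: "\<And>i. i < m \<Longrightarrow> S i \<in> space D"
    and W: "W \<in> supported_on d k I" and I: "I \<subseteq> {1..d}"
    and bound: "\<And>V e. (V, e) \<in> rational_params k I \<Longrightarrow>
      (\<Sum>i<m. measure D (err_set D tb d k V e) - indicator (err_set D tb d k V e) (S i)) \<le> m * u"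
  shows "pop_error D tb d k W \<le> emp_error S m tb d k W + u"
proof -
  interpret D: prob_space D by (rule D)
  obtain V where V: "\<And>q. (V q, 1 / real (Suc q)) \<in> rational_params k I"
    "\<And>x. eventually (\<lambda>q. near_argmax d k (V q) (1 / real (Suc q)) x = near_argmax d k W 0 x) sequentially"
    using rational_approximation[OF W I] by blast
  define A where "A q = err_set D tb d k (V q) (1 / real (Suc q))" for q
  define B where "B = err_set D tb d k W 0"
  have meas: "A q \<in> sets D" "B \<in> sets D" for q
    unfolding A_def B_def by (intro err_set_measurable[OF D(2)])+
  have ind: "(\<lambda>q. indicator (A q) z :: real) \<longlonglongrightarrow> indicator B z" for z
  proof (rule tendsto_eventually)
    show "eventually (\<lambda>q. indicator (A q) z = (indicator B z :: real)) sequentially"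
      using V(2)[of "fst z"] by eventually_elim (auto simp: A_def B_def err_set_def indicator_def)
  qed
  have "(\<lambda>q. \<integral>z. (indicator (A q) z :: real) \<partial>D) \<longlonglongrightarrow> (\<integral>z. indicator B z \<partial>D)"
    using meas ind by (intro integral_dominated_convergence[where w = "\<lambda>_. 1"]) (auto simp: indicator_def)
  then have "(\<lambda>q. measure D (A q)) \<longlonglongrightarrow> measure D B"
    using meas by simp
  then have "(\<lambda>q. \<Sum>i<m. measure D (A q) - indicator (A q) (S i)) \<longlonglongrightarrow> (\<Sum>i<m. measure D B - indicator B (S i))"
    by (intro tendsto_sum tendsto_diff ind)
  moreover have "(\<Sum>i<m. measure D (A q) - indicator (A q) (S i)) \<le> m * u" for q
    unfolding A_def by (rule bound[OF V(1)])
  ultimately have "(\<Sum>i<m. measure D B - indicator B (S i)) \<le> m * u"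
    by (intro LIMSEQ_le_const2) auto
  moreover have "measure D B = pop_error D tb d k W"
    by (simp add: pop_error_def B_def err_set_def predict_eq_near_argmax)
  moreover have "(\<Sum>i<m. indicator B (S i)) = m * emp_error S m tb d k W"
  proof -
    have "(\<Sum>i<m. indicator B (S i)) = (\<Sum>i<m. if predict tb d k W (fst (S i)) \<noteq> snd (S i) then 1 else 0 :: real)"
      using S by (intro sum.cong) (auto simp: B_def err_set_def predict_eq_near_argmax)
    then show ?thesis using m unfolding emp_error_def by (simp only:) simp
  qed
  ultimately have "m * pop_error D tb d k W \<le> m * (emp_error S m tb d k W + u)"
    by (simp add: sum_subtractf algebra_simps)
  then show ?thesis using m by simp
qed

section \<open>Supports of ShareBoost outputs and the union bound\<close>

text \<open>The support is recorded by the sequence of columns chosen in the rounds, repetitions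
  allowed; there are exactly \<open>d ^ T\<close> such sequences to sum over.\<close>

lemma shareboost_output_supported:
  assumes "shareboost_output d k m S T W" "T \<ge> 1"
  shows "\<exists>f\<in>PiE {..<T} (\<lambda>_. {1..d}). W \<in> supported_on d k (f ` {..<T})"
proof -
  obtain Ws Is where Is0: "Is 0 = {}"
    and step: "\<forall>t<T. \<exists>r\<in>{1..d}.
      (\<forall>r'\<in>{1..d}. grad_col_norm1 d k m S (Ws t) r' \<le> grad_col_norm1 d k m S (Ws t) r) \<and>
      Is (Suc t) = insert r (Is t) \<and>
      is_arg_min (train_loss d k m S) (\<lambda>V. V \<in> supported_on d k (Is (Suc t))) (Ws (Suc t))"
    and W: "W = Ws T"
    using assms(1) unfolding shareboost_output_def by (elim exE conjE) (rule that; assumption)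
  have "\<forall>t. \<exists>r. t < T \<longrightarrow> r \<in> {1..d} \<and> Is (Suc t) = insert r (Is t) \<and> Ws (Suc t) \<in> supported_on d k (Is (Suc t))"
    using step unfolding is_arg_min_def by blast
  from choice[OF this] obtain r where "\<forall>t. t < T \<longrightarrow> r t \<in> {1..d} \<and>
      Is (Suc t) = insert (r t) (Is t) \<and> Ws (Suc t) \<in> supported_on d k (Is (Suc t))" by blast
  then have r: "\<And>t. t < T \<Longrightarrow> r t \<in> {1..d}" "\<And>t. t < T \<Longrightarrow> Is (Suc t) = insert (r t) (Is t)"
    "\<And>t. t < T \<Longrightarrow> Ws (Suc t) \<in> supported_on d k (Is (Suc t))"
    by blast+
  have "t \<le> T \<Longrightarrow> Is t = r ` {..<t}" for t
    by (induction t) (auto simp: Is0 r(2) lessThan_Suc)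
  then have "Is T = restrict r {..<T} ` {..<T}" by auto
  moreover have "W \<in> supported_on d k (Is T)"
    \<comment> \<open>As \<open>T \<ge> 1\<close>, the output is the minimizer of round
      \<open>T - 1\<close> and thus feasible for the final column set.\<close>
    using r(3)[of "T - 1"] assms(2) by (simp add: W)
  ultimately show ?thesis using r(1) by (intro bexI[of _ "restrict r {..<T}"]) auto
qed

text \<open>The exceptional set is a measurable event defined by the rational class alone, while its
  complement controls all real matrices with the given support at once.\<close>

lemma supported_class_deviation:
  fixes D :: "example measure" and u \<delta> :: real
  assumes D: "prob_space D" "sets D = sets (example_space d)" and m: "m \<ge> 1"
    and I: "I \<subseteq> {1..d}" "card I \<le> T" and k: "k \<ge> 1" and \<delta>: "\<delta> > 0" and u: "u \<ge> 0"
    and mu: "40 * (12 * real (T * k + 1) * ln (4 * real (T * k + 1) * real (k * k)) + ln (1 / \<delta>)) \<le> m * u\<^sup>2"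
  shows "\<exists>Bad \<in> sets (\<Pi>\<^sub>M i\<in>{..<m}. D). measure (\<Pi>\<^sub>M i\<in>{..<m}. D) Bad \<le> \<delta> \<and>
    (\<forall>S \<in> space (\<Pi>\<^sub>M i\<in>{..<m}. D) - Bad. \<forall>W \<in> supported_on d k I.
       pop_error D tb d k W \<le> emp_error S m tb d k W + u)"
proof -
  define P where "P = (\<Pi>\<^sub>M i\<in>{..<m}. D)"
  define F where "F = (\<lambda>(V, e). err_set D tb d k V e) ` rational_params k I"
  have finI: "finite I" using I(1) by (rule finite_subset) simp
  define A where "A = from_nat_into F"
  have "rational_params k I \<noteq> {}"
    by (auto simp: rational_params_def PiE_eq_empty_iff intro: Rats_0)
  then have ran: "range A = F"
    unfolding A_def using countable_rational_params[OF finI]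
    by (intro range_from_nat_into) (auto simp: F_def)
  have Fsets: "F \<subseteq> sets D" by (auto simp: F_def intro!: err_set_measurable[OF D(2)])
  have "k * card I + 1 \<le> T * k + 1" using I(2) by simp
  then have gr: "growth_bounded (space D) F (k * k) (T * k + 1)"
    unfolding F_def
    by (intro growth_bounded_exponent_mono[OF growth_bounded_err_sets[OF I(1) rational_params_subset[OF I(1)]]])
  define Bad where "Bad = {S \<in> space P. \<exists>q. m * u < (\<Sum>i<m. measure D (A q) - indicator (A q) (S i))}"
  have "Bad \<in> sets P" "measure P Bad \<le> \<delta>"
    using uniform_deviation_sequence[OF D(1) m _ _ _ _ \<delta> u mu, of A] Fsets gr k
    unfolding Bad_def P_def ran by auto
  moreover have "pop_error D tb d k W \<le> emp_error S m tb d k W + u"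
    if S: "S \<in> space P - Bad" and W: "W \<in> supported_on d k I" for S W
  proof (rule pop_error_le_of_rational_params[OF D m _ W I(1)])
    show "S i \<in> space D" if "i < m" for i using S that by (auto simp: P_def space_PiM)
    fix V e assume "(V, e) \<in> rational_params k I"
    then have "err_set D tb d k V e \<in> range A" unfolding ran F_def by force
    then obtain q where "err_set D tb d k V e = A q" by blast
    then show "(\<Sum>i<m. measure D (err_set D tb d k V e) - indicator (err_set D tb d k V e) (S i)) \<le> m * u"
      using S by (auto simp: Bad_def not_less)
  qed
  ultimately show ?thesis unfolding P_def by blast
qed

text \<open>With \<open>N = T k\<close> one has \<open>n \<le> 2 N\<close> and
  \<open>4 n k^2 \<le> 8 N^3 \<le> N^6\<close>, as \<open>N \<ge> 2\<close>. The factor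
  \<open>ln k \<ge> 1/2\<close> turns \<open>12 * 2 * 6 = 144\<close> into
  \<open>288\<close>.\<close>

lemma complexity_term_le:
  fixes T k :: nat
  assumes T: "T \<ge> 1" and k: "k \<ge> 2"
  shows "12 * real (T * k + 1) * ln (4 * real (T * k + 1) * real (k * k))
     \<le> 288 * (real T * real k * ln (real T * real k) * ln (real k))"
proof -
  define N where "N = real T * real k"
  have N: "2 \<le> N" "real k \<le> N"
    unfolding N_def using T k mult_mono[of 1 "real T" 2 "real k"] by (auto simp: mult_le_cancel_right1)
  have n: "real (T * k + 1) \<le> 2 * N" using N by (simp add: N_def)
  have "4 * real (T * k + 1) * real (k * k) \<le> 4 * (2 * N) * (N * N)"
    using n N by (intro mult_mono) (auto intro!: mult_mono)
  also have "\<dots> = 2 ^ 3 * N ^ 3" by (simp add: power3_eq_cube)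
  also have "\<dots> \<le> N ^ 3 * N ^ 3"
    using N by (intro mult_right_mono power_mono) auto
  finally have "ln (4 * real (T * k + 1) * real (k * k)) \<le> ln (N ^ 3 * N ^ 3)"
    using k by (intro ln_mono mult_pos_pos) (auto intro: add_pos_nonneg)
  also have "\<dots> = 6 * ln N" using N by (simp add: ln_realpow flip: power_add)
  finally have L: "ln (4 * real (T * k + 1) * real (k * k)) \<le> 6 * ln N" .
  have lnN: "0 \<le> ln N" using N by simp
  have "1 / 2 \<le> ln (2 :: real)" using ln2_ge_two_thirds by linarith
  also have "\<dots> \<le> ln (real k)" using k by (intro ln_mono) auto
  finally have lnk: "1 / 2 \<le> ln (real k)" .
  have "12 * real (T * k + 1) * ln (4 * real (T * k + 1) * real (k * k)) \<le> 12 * real (T * k + 1) * (6 * ln N)"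
    using L by (intro mult_left_mono) auto
  also have "\<dots> \<le> 12 * (2 * N) * (6 * ln N)"
    using n lnN by (intro mult_right_mono) auto
  also have "\<dots> = 288 * (N * ln N) * (1 / 2)" by simp
  also have "\<dots> \<le> 288 * (N * ln N) * ln (real k)"
    using lnk lnN N by (intro mult_left_mono) auto
  finally show ?thesis by (simp add: N_def mult_ac)
qed

theorem theorem1:
  shows "\<exists>C>0. \<forall>(d::nat) (k::nat) (m::nat) (T::nat) (D :: example measure) (\<delta>::real)
            (tb :: nat set \<Rightarrow> nat).
     d \<ge> 1 \<longrightarrow> k \<ge> 1 \<longrightarrow> m \<ge> 1 \<longrightarrow> T \<ge> 1 \<longrightarrow>
     prob_space D \<longrightarrow> sets D = sets (example_space d) \<longrightarrow>
     (AE z in D. (\<forall>r\<in>{1..d}. fst z r \<in> {-1..1}) \<and> snd z \<in> {1..k}) \<longrightarrow>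
     0 < \<delta> \<longrightarrow> \<delta> < 1 \<longrightarrow>
     (\<forall>A. A \<noteq> {} \<longrightarrow> tb A \<in> A) \<longrightarrow>
     (\<exists>E \<in> sets (\<Pi>\<^sub>M i\<in>{..<m}. D).
        measure (\<Pi>\<^sub>M i\<in>{..<m}. D) E \<ge> 1 - \<delta> \<and>
        (\<forall>S\<in>E. \<forall>W. shareboost_output d k m S T W \<longrightarrow>
           pop_error D tb d k W
             \<le> emp_error S m tb d k W
               + C * sqrt ((real T * real k * ln (real T * real k) * ln (real k)
                            + real T * ln (real d) + ln (1 / \<delta>)) / real m)))"
\<comment> \<open>The constant is chosen so that \<open>108^2 = 11664\<close> exceeds
  \<open>40 * 288 = 11520\<close>.\<close>
proof (rule exI[of _ 108], intro conjI allI impI)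
  fix d k m T :: nat and D :: "example measure" and \<delta> :: real and tb :: "nat set \<Rightarrow> nat"
  assume d: "d \<ge> 1" and k: "k \<ge> 1" and m: "m \<ge> 1" and T: "T \<ge> 1"
    and D: "prob_space D" "sets D = sets (example_space d)"
    and AE: "AE z in D. (\<forall>r\<in>{1..d}. fst z r \<in> {-1..1}) \<and> snd z \<in> {1..k}"
    and \<delta>: "0 < \<delta>" "\<delta> < 1" and tb: "\<forall>A. A \<noteq> {} \<longrightarrow> tb A \<in> A"
  interpret D: prob_space D by (rule D)
  define P where "P = (\<Pi>\<^sub>M i\<in>{..<m}. D)"
  interpret P: prob_space P unfolding P_def using D(1) by (intro prob_space_PiM) auto
  define X where "X = real T * real k * ln (real T * real k) * ln (real k)"
  define R where "R = X + real T * ln (real d) + ln (1 / \<delta>)"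
  define u where "u = 108 * sqrt (R / m)"
  have Tk: "1 \<le> real T * real k" using T k mult_mono[of 1 "real T" 1 "real k"] by simp
  have X0: "0 \<le> X" unfolding X_def using Tk T k by (intro mult_nonneg_nonneg) auto
  have Td0: "0 \<le> real T * ln (real d)" using d by simp
  have l\<delta>: "0 \<le> ln (1 / \<delta>)" using \<delta> by simp
  have R0: "0 \<le> R" using X0 Td0 l\<delta> by (simp add: R_def)
  have u0: "0 \<le> u" using R0 by (simp add: u_def)
  have "\<exists>E \<in> sets P. 1 - \<delta> \<le> measure P E \<and>
      (\<forall>S\<in>E. \<forall>W. shareboost_output d k m S T W \<longrightarrow> pop_error D tb d k W \<le> emp_error S m tb d k W + u)"
  proof (cases "k = 1")
    case True
    \<comment> \<open>With a single label the maximizers are \<open>{1}\<close>, and almost every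
      example carries label \<open>1\<close>; the whole sample space serves as
      \<open>E\<close>.\<close>
    have "pop_error D tb d k W = 0" for W
    proof -
      have "near_argmax d k W 0 x = {1}" for x by (auto simp: near_argmax_def True)
      then have "predict tb d k W x = 1" for x using tb by (auto simp: predict_eq_near_argmax)
      then have "AE z in D. \<not> predict tb d k W (fst z) \<noteq> snd z"
        using AE by (auto simp: True)
      then show ?thesis unfolding pop_error_def
        by (subst D.prob_eq_0_AE[symmetric]) auto
    qed
    moreover have "0 \<le> emp_error S m tb d k W" for S W
      unfolding emp_error_def by (intro mult_nonneg_nonneg sum_nonneg) auto
    ultimately show ?thesis
      using u0 \<delta> by (intro bexI[of _ "space P"]) (auto simp: P.prob_space add_nonneg_nonneg)
  next
    case False
    then have k2: "k \<ge> 2" using k by simp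
    define Fs where "Fs = PiE {..<T} (\<lambda>_. {1..d})"
    have finFs: "finite Fs" and cardFs: "card Fs = d ^ T" unfolding Fs_def by (auto intro: finite_PiE simp: card_PiE)
    \<comment> \<open>Dividing the confidence evenly among the \<open>d ^ T\<close> column sequences
      produces the term \<open>T * ln d\<close>.\<close>
    define \<delta>' where "\<delta>' = \<delta> / d ^ T"
    have \<delta>': "\<delta>' > 0" using \<delta> d by (simp add: \<delta>'_def)
    have ln\<delta>': "ln (1 / \<delta>') = real T * ln (real d) + ln (1 / \<delta>)"
      using \<delta> d by (simp add: \<delta>'_def ln_div ln_realpow)
    have "40 * (12 * real (T * k + 1) * ln (4 * real (T * k + 1) * real (k * k)) + ln (1 / \<delta>'))
        \<le> 40 * (288 * X + (real T * ln (real d) + ln (1 / \<delta>)))"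
      using complexity_term_le[OF T k2] unfolding ln\<delta>' X_def by (intro mult_left_mono add_right_mono) auto
    also have "\<dots> \<le> 108\<^sup>2 * R" using X0 Td0 l\<delta> by (simp add: R_def)
    also have "\<dots> = m * u\<^sup>2" using R0 m by (simp add: u_def power_mult_distrib)
    finally have mu: "40 * (12 * real (T * k + 1) * ln (4 * real (T * k + 1) * real (k * k)) + ln (1 / \<delta>')) \<le> m * u\<^sup>2" .
    have "\<exists>Bad \<in> sets P. measure P Bad \<le> \<delta>' \<and>
        (\<forall>S \<in> space P - Bad. \<forall>W \<in> supported_on d k (f ` {..<T}).
           pop_error D tb d k W \<le> emp_error S m tb d k W + u)" if "f \<in> Fs" for f
    proof -
      have "f ` {..<T} \<subseteq> {1..d}" using that by (auto simp: Fs_def)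
      moreover have "card (f ` {..<T}) \<le> T" using card_image_le[of "{..<T}" f] by simp
      ultimately show ?thesis
        unfolding P_def by (rule supported_class_deviation[OF D m _ _ k \<delta>' u0 mu])
    qed
    then obtain Bad where Bad: "\<And>f. f \<in> Fs \<Longrightarrow> Bad f \<in> sets P" "\<And>f. f \<in> Fs \<Longrightarrow> measure P (Bad f) \<le> \<delta>'"
      "\<And>f S W. f \<in> Fs \<Longrightarrow> S \<in> space P - Bad f \<Longrightarrow> W \<in> supported_on d k (f ` {..<T}) \<Longrightarrow>
         pop_error D tb d k W \<le> emp_error S m tb d k W + u"
      by metis
    define E where "E = space P - (\<Union>f\<in>Fs. Bad f)"
    have Un: "(\<Union>f\<in>Fs. Bad f) \<in> sets P" using Bad(1) finFs by auto
    have "measure P (\<Union>f\<in>Fs. Bad f) \<le> (\<Sum>f\<in>Fs. measure P (Bad f))"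
      using finFs Bad(1) by (intro P.finite_measure_subadditive_finite) auto
    also have "\<dots> \<le> card Fs * \<delta>'" using Bad(2) by (rule sum_bounded_above)
    also have "\<dots> = \<delta>" using d by (simp add: cardFs \<delta>'_def)
    finally have "1 - \<delta> \<le> measure P E" unfolding E_def using P.prob_compl[OF Un] by simp
    moreover have "E \<in> sets P" unfolding E_def using Un by auto
    moreover have "pop_error D tb d k W \<le> emp_error S m tb d k W + u"
      if S: "S \<in> E" and out: "shareboost_output d k m S T W" for S W
    proof -
      obtain f where "f \<in> Fs" "W \<in> supported_on d k (f ` {..<T})"
        using shareboost_output_supported[OF out T] unfolding Fs_def by blast
      then show ?thesis using S by (intro Bad(3)) (auto simp: E_def)
    qed
    ultimately show ?thesis by blast
  qed
  then show "\<exists>E \<in> sets (\<Pi>\<^sub>M i\<in>{..<m}. D).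
        measure (\<Pi>\<^sub>M i\<in>{..<m}. D) E \<ge> 1 - \<delta> \<and>
        (\<forall>S\<in>E. \<forall>W. shareboost_output d k m S T W \<longrightarrow>
           pop_error D tb d k W
             \<le> emp_error S m tb d k W
               + 108 * sqrt ((real T * real k * ln (real T * real k) * ln (real k)
                            + real T * ln (real d) + ln (1 / \<delta>)) / real m))"
    unfolding P_def u_def R_def X_def .
qed simp

end
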